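(* Let $\kappa>0$ and $\tau\neq0$ be real numbers with $4\tau^2>\kappa$, let $\mathbb{S}^3_{\kappa,\tau}=(\mathbb{S}^3,g_{\kappa,\tau})$ be the corresponding Berger sphere with vertical vector field $E_3=\frac{\kappa}{4\tau}V$, and let $0<m<\infty$. Put $X=\sqrt{m(4\tau^2-\kappa)}\,E_3$ and $\lambda=\kappa-2\tau^2$. Then $$Ric+\frac12\mathcal{L}_X g_{\kappa,\tau}-\frac1m X^\flat\otimes X^\flat=\lambda\, g_{\kappa,\tau},$$ so $(\mathbb{S}^3_{\kappa,\tau},X,\lambda)$ is an $m$-quasi-Einstein structure; it is nontrivial (i.e. $X\not\equiv0$), and $X$ is not the gradient of any smooth function on $\mathbb{S}^3_{\kappa,\tau}$.
   Context: The Berger sphere $\mathbb{S}^3_{\kappa,\tau}$ is $\mathbb{S}^3=\{(z,w)\in\mathbb{C}^2: |z|^2+|w|^2=1\}$ endowed with the metric $$g_{\kappa,\tau}(X,Y)=\frac4\kappa\Big[\langle X,Y\rangle+\Big(\frac{4\tau^2}{\kappa}-1\Big)\langle X,V\rangle\langle Y,V\rangle\Big],$$ where $\langle\cdot,\cdot\rangle$ is the round metric of $\mathbb{S}^3$ (curvature $1$) and $V_{(z,w)}=(iz,iw)$. $\mathcal{L}_X$ denotes the Lie derivative and $X^\flat=g_{\kappa,\tau}(X,\cdot)$. *)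

theory Defs
  imports "HOL-Analysis.Analysis"
begin

text \<open>
  The sphere is treated as an embedded submanifold of the real inner product space
  complex * complex.  Functions and vector fields on it are total functions on the ambient
  space of which only the values on the sphere matter.
\<close>

type_synonym cc = "complex \<times> complex"

type_synonym vfield = "cc \<Rightarrow> cc"

abbreviation S3 :: "cc set" where
  "S3 \<equiv> sphere 0 1"

definition tangent_space :: "cc \<Rightarrow> cc set" where
  "tangent_space p = {v. v \<bullet> p = 0}"


subsection \<open>Smooth functions and vector fields\<close>

text \<open>Only meant for open sets \<open>U\<close>.\<close>

primrec Ck_on :: "nat \<Rightarrow> 'a::euclidean_space set \<Rightarrow> ('a \<Rightarrow> 'b::real_normed_vector) \<Rightarrow> bool" where
  "Ck_on 0 U f \<longleftrightarrow> continuous_on U f"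
| "Ck_on (Suc k) U f \<longleftrightarrow>
     (\<forall>x\<in>U. f differentiable (at x)) \<and> (\<forall>v. Ck_on k U (\<lambda>x. frechet_derivative f (at x) v))"

definition smooth_S3 :: "(cc \<Rightarrow> 'b::real_normed_vector) \<Rightarrow> bool" where
  "smooth_S3 f \<longleftrightarrow>
     (\<forall>p\<in>S3. \<exists>U F. open U \<and> p \<in> U \<and> (\<forall>k. Ck_on k U F) \<and> (\<forall>q\<in>U \<inter> S3. F q = f q))"

definition smooth_vfield :: "vfield \<Rightarrow> bool" where
  "smooth_vfield X \<longleftrightarrow> smooth_S3 X \<and> (\<forall>p\<in>S3. X p \<in> tangent_space p)"

text \<open>
  The differential of a function on the sphere.  The derivative relative to the sphere is not
  unique as a linear map on the ambient space, but its values on tangent vectors are, so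
  \<open>d_S3 f p v\<close> is only meaningful for \<open>v \<in> tangent_space p\<close>.
\<close>

definition d_S3 :: "(cc \<Rightarrow> 'b::real_normed_vector) \<Rightarrow> cc \<Rightarrow> cc \<Rightarrow> 'b" where
  "d_S3 f p v = frechet_derivative f (at p within S3) v"

text \<open>The usual coordinate formula, in the coordinates of the ambient space.\<close>

definition lie_bracket :: "vfield \<Rightarrow> vfield \<Rightarrow> vfield" where
  "lie_bracket X Y = (\<lambda>p. d_S3 Y p (X p) - d_S3 X p (Y p))"


subsection \<open>Riemannian metrics, Levi-Civita connection and curvature\<close>

type_synonym metric = "cc \<Rightarrow> cc \<Rightarrow> cc \<Rightarrow> real"

definition riemannian_metric :: "metric \<Rightarrow> bool" where
  "riemannian_metric g \<longleftrightarrow>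
     (\<forall>p\<in>S3. \<forall>u\<in>tangent_space p. \<forall>v\<in>tangent_space p. \<forall>w\<in>tangent_space p. \<forall>a b.
        g p (a *\<^sub>R u + b *\<^sub>R v) w = a * g p u w + b * g p v w) \<and>
     (\<forall>p\<in>S3. \<forall>u\<in>tangent_space p. \<forall>v\<in>tangent_space p. g p u v = g p v u) \<and>
     (\<forall>p\<in>S3. \<forall>u\<in>tangent_space p. u \<noteq> 0 \<longrightarrow> g p u u > 0) \<and>
     (\<forall>Y Z. smooth_vfield Y \<longrightarrow> smooth_vfield Z \<longrightarrow> smooth_S3 (\<lambda>p. g p (Y p) (Z p)))"

definition affine_connection :: "(vfield \<Rightarrow> vfield \<Rightarrow> vfield) \<Rightarrow> bool" where
  "affine_connection D \<longleftrightarrow>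
     (\<forall>X Y. smooth_vfield X \<longrightarrow> smooth_vfield Y \<longrightarrow> smooth_vfield (D X Y)) \<and>
     (\<forall>X X' Y. smooth_vfield X \<longrightarrow> smooth_vfield X' \<longrightarrow> smooth_vfield Y \<longrightarrow>
        (\<forall>p\<in>S3. D (\<lambda>q. X q + X' q) Y p = D X Y p + D X' Y p)) \<and>
     (\<forall>f X Y. smooth_S3 f \<longrightarrow> smooth_vfield X \<longrightarrow> smooth_vfield Y \<longrightarrow>
        (\<forall>p\<in>S3. D (\<lambda>q. f q *\<^sub>R X q) Y p = f p *\<^sub>R D X Y p)) \<and>
     (\<forall>X Y Y'. smooth_vfield X \<longrightarrow> smooth_vfield Y \<longrightarrow> smooth_vfield Y' \<longrightarrow>
        (\<forall>p\<in>S3. D X (\<lambda>q. Y q + Y' q) p = D X Y p + D X Y' p)) \<and>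
     (\<forall>f X Y. smooth_S3 f \<longrightarrow> smooth_vfield X \<longrightarrow> smooth_vfield Y \<longrightarrow>
        (\<forall>p\<in>S3. D X (\<lambda>q. f q *\<^sub>R Y q) p = d_S3 f p (X p) *\<^sub>R Y p + f p *\<^sub>R D X Y p))"

definition is_levi_civita :: "metric \<Rightarrow> (vfield \<Rightarrow> vfield \<Rightarrow> vfield) \<Rightarrow> bool" where
  "is_levi_civita g D \<longleftrightarrow> affine_connection D \<and>
     (\<forall>X Y. smooth_vfield X \<longrightarrow> smooth_vfield Y \<longrightarrow>
        (\<forall>p\<in>S3. D X Y p - D Y X p = lie_bracket X Y p)) \<and>
     (\<forall>X Y Z. smooth_vfield X \<longrightarrow> smooth_vfield Y \<longrightarrow> smooth_vfield Z \<longrightarrow>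
        (\<forall>p\<in>S3. d_S3 (\<lambda>q. g q (Y q) (Z q)) p (X p) = g p (D X Y p) (Z p) + g p (Y p) (D X Z p)))"

text \<open>
  For a Riemannian metric the choice is unique on the sphere and on smooth vector fields;
  elsewhere the value is irrelevant, which is why \<open>SOME\<close> is used instead of \<open>THE\<close>.
\<close>

definition levi_civita :: "metric \<Rightarrow> vfield \<Rightarrow> vfield \<Rightarrow> vfield" where
  "levi_civita g = (SOME D. is_levi_civita g D)"

definition curvature :: "metric \<Rightarrow> vfield \<Rightarrow> vfield \<Rightarrow> vfield \<Rightarrow> vfield" where
  "curvature g X Y Z = (\<lambda>p.
     levi_civita g X (levi_civita g Y Z) p - levi_civita g Y (levi_civita g X Z) p
       - levi_civita g (lie_bracket X Y) Z p)"

text \<open>Trace of an endomorphism of the subspace \<open>W\<close>, computed in an arbitrary basis of \<open>W\<close>.\<close>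

definition trace_on :: "'a::euclidean_space set \<Rightarrow> ('a \<Rightarrow> 'a) \<Rightarrow> real" where
  "trace_on W L = (let B = (SOME B. independent B \<and> span B = W)
     in \<Sum>b\<in>B. representation B (L b) b)"

definition extension_field :: "cc \<Rightarrow> cc \<Rightarrow> vfield" where
  "extension_field p v = (SOME X. smooth_vfield X \<and> X p = v)"

text \<open>
  \<open>Ric(Y,Z)\<close> is the trace of \<open>x \<mapsto> R(x,Y)Z\<close>; the value at \<open>p\<close> of the curvature depends
  only on the value at \<open>p\<close> of the extension of \<open>x\<close>.
\<close>

definition ricci :: "metric \<Rightarrow> vfield \<Rightarrow> vfield \<Rightarrow> cc \<Rightarrow> real" where
  "ricci g Y Z p = trace_on (tangent_space p) (\<lambda>x. curvature g (extension_field p x) Y Z p)"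

definition lie_derivative :: "vfield \<Rightarrow> metric \<Rightarrow> vfield \<Rightarrow> vfield \<Rightarrow> cc \<Rightarrow> real" where
  "lie_derivative X g Y Z p = d_S3 (\<lambda>q. g q (Y q) (Z q)) p (X p)
     - g p (lie_bracket X Y p) (Z p) - g p (Y p) (lie_bracket X Z p)"

definition flat :: "metric \<Rightarrow> vfield \<Rightarrow> vfield \<Rightarrow> cc \<Rightarrow> real" where
  "flat g X Y p = g p (X p) (Y p)"

definition is_gradient :: "metric \<Rightarrow> vfield \<Rightarrow> (cc \<Rightarrow> real) \<Rightarrow> bool" where
  "is_gradient g X f \<longleftrightarrow> (\<forall>p\<in>S3. \<forall>v\<in>tangent_space p. g p (X p) v = d_S3 f p v)"

text \<open>
  Identities between 2-tensor fields are expressed by evaluation on all pairs of smooth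
  vector fields.
\<close>

definition quasi_einstein_structure :: "real \<Rightarrow> metric \<Rightarrow> vfield \<Rightarrow> real \<Rightarrow> bool" where
  "quasi_einstein_structure m g X l \<longleftrightarrow> 0 < m \<and> riemannian_metric g \<and> smooth_vfield X \<and>
     (\<forall>Y Z. smooth_vfield Y \<longrightarrow> smooth_vfield Z \<longrightarrow>
        (\<forall>p\<in>S3. ricci g Y Z p + 1 / 2 * lie_derivative X g Y Z p
           - 1 / m * (flat g X Y p * flat g X Z p) = l * g p (Y p) (Z p)))"


subsection \<open>Berger spheres\<close>

definition vert :: vfield where
  "vert p = (\<i> * fst p, \<i> * snd p)"

definition berger_metric :: "real \<Rightarrow> real \<Rightarrow> metric" where
  "berger_metric \<kappa> \<tau> p u v =
     4 / \<kappa> * (u \<bullet> v + (4 * \<tau>\<^sup>2 / \<kappa> - 1) * (u \<bullet> vert p) * (v \<bullet> vert p))"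

definition berger_E3 :: "real \<Rightarrow> real \<Rightarrow> vfield" where
  "berger_E3 \<kappa> \<tau> p = (\<kappa> / (4 * \<tau>)) *\<^sub>R vert p"

end

theory Submission
  imports Defs
begin

text \<open>
  Put \<open>c = 4 \<tau>\<^sup>2 / \<kappa> - 1\<close>, \<open>J = vert\<close> (multiplication by \<open>\<i>\<close>) and \<open>\<eta>(x) = x \<bullet> J p\<close>.  In ambient
  coordinates the Levi-Civita connection of the Berger metric is the derivative plus the symmetric
  form \<open>B\<^sub>p(x, y) = (x \<bullet> y) p + c (\<eta>(x) J y + \<eta>(y) J x + 2 \<eta>(x) \<eta>(y) p)\<close>; torsion-freeness and
  metric compatibility determine it.  In the curvature the derivatives of the fields cancel because
  second derivatives of local extensions commute, so that \<open>R(x, y) z\<close> is algebraic in \<open>B\<close> and its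
  derivative in \<open>p\<close>.  Tracing gives \<open>Ric(y, z) = (2 - 2 c) (y \<bullet> z) + (6 c + 2 c\<^sup>2) \<eta>(y) \<eta>(z)\<close>, and
  subtracting \<open>X\<^sup>\<flat> \<otimes> X\<^sup>\<flat> / m\<close>, which is \<open>4 c (1 + c) \<eta>(y) \<eta>(z)\<close>, leaves \<open>\<lambda> g\<close>.  The Lie derivative
  vanishes since \<open>X\<close> is Killing.  A gradient on the compact sphere vanishes at a maximum of its
  potential, whereas \<open>X\<close> has no zeros.
\<close>

subsection \<open>Calculus of \<open>Ck_on\<close>\<close>

text \<open>On an open set, agreement of two functions passes to their derivatives, so the induction
  can replace both by their directional derivatives.\<close>

lemma Ck_on_cong:
  assumes "open U" "\<And>x. x \<in> U \<Longrightarrow> f x = g x" "Ck_on k U f"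
  shows "Ck_on k U g"
  using assms(2,3)
proof (induction k arbitrary: f g)
  case 0
  then show ?case by (simp cong: continuous_on_cong)
next
  case (Suc k)
  have d: "(g has_derivative frechet_derivative f (at x)) (at x)" if "x \<in> U" for x
    using Suc.prems that \<open>open U\<close>
    by (auto simp: frechet_derivative_works intro: has_derivative_transform_within_open)
  then have e: "frechet_derivative f (at x) = frechet_derivative g (at x)" if "x \<in> U" for x
    using that by (blast intro: frechet_derivative_at)
  have "Ck_on k U (\<lambda>x. frechet_derivative g (at x) v)" for v
    using Suc.IH[of "\<lambda>x. frechet_derivative f (at x) v"] Suc.prems(2) e by simp
  then show ?case
    using d by (auto simp: differentiable_def)
qed

text \<open>Lets any derivative found by the calculus rules stand in for the choice made by
  \<open>frechet_derivative\<close>.\<close>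

lemma Ck_on_SucI:
  assumes "open U" "\<And>x. x \<in> U \<Longrightarrow> (f has_derivative f' x) (at x)"
    and "\<And>v. Ck_on k U (\<lambda>x. f' x v)"
  shows "Ck_on (Suc k) U f"
proof -
  have "Ck_on k U (\<lambda>x. frechet_derivative f (at x) v)" for v
    using frechet_derivative_at[OF assms(2)] by (intro Ck_on_cong[OF assms(1) _ assms(3)[of v]]) metis
  then show ?thesis
    using assms(2) by (auto simp: differentiable_def)
qed

lemma Ck_on_Suc_has_derivative:
  "Ck_on (Suc k) U f \<Longrightarrow> x \<in> U \<Longrightarrow> (f has_derivative frechet_derivative f (at x)) (at x)"
  by (simp add: frechet_derivative_works)

lemma Ck_on_SucD: "Ck_on (Suc k) U f \<Longrightarrow> Ck_on k U f"
proof (induction k arbitrary: f)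
  case 0
  then show ?case
    by (auto intro!: continuous_at_imp_continuous_on differentiable_imp_continuous_within)
qed simp

lemma Ck_on_subset: "Ck_on k U f \<Longrightarrow> V \<subseteq> U \<Longrightarrow> Ck_on k V f"
  by (induction k arbitrary: f) (auto intro: continuous_on_subset)

lemma Ck_on_const: "Ck_on k U (\<lambda>x. c)"
  by (induction k arbitrary: c) auto

lemma Ck_on_bounded_linear:
  assumes "bounded_linear T" "open U"
  shows "Ck_on k U T"
proof (cases k)
  case 0
  then show ?thesis using assms by (simp add: linear_continuous_on)
next
  case (Suc j)
  show ?thesis
    unfolding Suc
    by (rule Ck_on_SucI[OF assms(2) bounded_linear_imp_has_derivative[OF assms(1)] Ck_on_const])
qed

lemma Ck_on_add:
  assumes "open U" "Ck_on k U f" "Ck_on k U g"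
  shows "Ck_on k U (\<lambda>x. f x + g x)"
  using assms(2,3)
proof (induction k arbitrary: f g)
  case 0
  then show ?case by (simp add: continuous_on_add)
next
  case (Suc k)
  show ?case
    by (rule Ck_on_SucI[OF assms(1) has_derivative_add])
      (use Suc in \<open>auto intro: Ck_on_Suc_has_derivative simp del: Ck_on.simps(2)\<close>, simp)
qed

lemma Ck_on_sum:
  assumes "open U" "finite I" "\<And>i. i \<in> I \<Longrightarrow> Ck_on k U (f i)"
  shows "Ck_on k U (\<lambda>x. \<Sum>i\<in>I. f i x)"
  using assms(2,3) by (induction I) (auto simp: Ck_on_const intro: Ck_on_add[OF assms(1)])

text \<open>Leibniz rule: each summand of the derivative is again \<open>h\<close> of one
  undifferentiated and one differentiated factor, both of class \<open>k\<close>, so the induction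
  hypothesis applies.\<close>

lemma Ck_on_bilinear:
  assumes "open U" "bounded_bilinear h" "Ck_on k U f" "Ck_on k U g"
  shows "Ck_on k U (\<lambda>x. h (f x) (g x))"
  using assms(3,4)
proof (induction k arbitrary: f g)
  case 0
  then show ?case by (simp add: bounded_bilinear.continuous_on[OF assms(2)])
next
  case (Suc k)
  show ?case
  proof (rule Ck_on_SucI[OF assms(1)])
    show "((\<lambda>x. h (f x) (g x)) has_derivative
      (\<lambda>v. h (f x) (frechet_derivative g (at x) v) + h (frechet_derivative f (at x) v) (g x))) (at x)"
      if "x \<in> U" for x
      using Suc.prems that
      by (intro bounded_bilinear.FDERIV[OF assms(2)]) (blast intro: Ck_on_Suc_has_derivative)+
    show "Ck_on k U (\<lambda>x. h (f x) (frechet_derivative g (at x) v) +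
      h (frechet_derivative f (at x) v) (g x))" for v
      using Suc.prems by (intro Ck_on_add[OF assms(1)] Suc.IH) (auto dest: Ck_on_SucD simp del: Ck_on.simps(2), simp_all)
  qed
qed

lemma Ck_on_bounded_linear_compose:
  assumes "open U" "bounded_linear T" "Ck_on k U f"
  shows "Ck_on k U (\<lambda>x. T (f x))"
  using assms(3)
proof (induction k arbitrary: f)
  case 0
  then show ?case
    by (simp add: bounded_linear.continuous_on[OF assms(2)])
next
  case (Suc k)
  show ?case
    by (rule Ck_on_SucI[OF assms(1) bounded_linear.has_derivative[OF assms(2)]])
      (use Suc in \<open>auto intro: Ck_on_Suc_has_derivative simp del: Ck_on.simps(2)\<close>, simp add: Suc.IH)
qed

text \<open>\<open>Ck_on\<close> controls derivatives only in constant directions; expanding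
  \<open>G x\<close> in the standard basis reduces a variable direction to these.\<close>

lemma Ck_on_directional_derivative:
  fixes F :: "'a::euclidean_space \<Rightarrow> 'b::real_normed_vector" and G :: "'a \<Rightarrow> 'a"
  assumes "open U" "Ck_on (Suc k) U F" "Ck_on k U G"
  shows "Ck_on k U (\<lambda>x. frechet_derivative F (at x) (G x))"
proof (rule Ck_on_cong[OF assms(1)])
  show "Ck_on k U (\<lambda>x. \<Sum>b\<in>Basis. (G x \<bullet> b) *\<^sub>R frechet_derivative F (at x) b)"
    using assms
    by (intro Ck_on_sum Ck_on_bilinear[OF _ bounded_bilinear_scaleR]
        Ck_on_bounded_linear_compose[OF _ bounded_linear_inner_left]) auto
next
  fix x assume "x \<in> U"
  then have "linear (frechet_derivative F (at x))"
    using assms(2) by (simp add: linear_frechet_derivative)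
  then have "frechet_derivative F (at x) (\<Sum>b\<in>Basis. (G x \<bullet> b) *\<^sub>R b) =
      (\<Sum>b\<in>Basis. (G x \<bullet> b) *\<^sub>R frechet_derivative F (at x) b)"
    by (simp add: linear_sum linear_cmul)
  then show "(\<Sum>b\<in>Basis. (G x \<bullet> b) *\<^sub>R frechet_derivative F (at x) b) =
      frechet_derivative F (at x) (G x)"
    by (simp add: euclidean_representation)
qed


subsection \<open>Symmetry of second derivatives\<close>

text \<open>The mean value theorem is applied twice: along \<open>u\<close> to the increment of
  \<open>f\<close> in direction \<open>t *\<^sub>R v\<close>, then along \<open>v\<close> to the
  resulting derivative. The second difference on the left is symmetric in \<open>u\<close> and
  \<open>v\<close>, so exchanging the roles compares the two mixed derivatives.\<close>

lemma second_difference_mvt: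
  fixes f :: "'a::real_normed_vector \<Rightarrow> real"
  assumes "0 < t" "t * (norm u + norm v) < r"
    and f': "\<And>y. y \<in> ball x r \<Longrightarrow> (f has_derivative f' y) (at y)"
    and P: "\<And>y. y \<in> ball x r \<Longrightarrow> ((\<lambda>z. f' z u) has_derivative P y) (at y)"
  obtains y where "dist x y \<le> t * (norm u + norm v)"
    and "f (x + t *\<^sub>R u + t *\<^sub>R v) - f (x + t *\<^sub>R u) - f (x + t *\<^sub>R v) + f x = t * t * P y v"
proof -
  have in_ball: "x + a *\<^sub>R u + b *\<^sub>R v \<in> ball x r"
    and dist_le: "dist x (x + a *\<^sub>R u + b *\<^sub>R v) \<le> t * (norm u + norm v)"
    if "0 \<le> a" "a \<le> t" "0 \<le> b" "b \<le> t" for a b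
  proof -
    have "dist x (x + a *\<^sub>R u + b *\<^sub>R v) = norm (a *\<^sub>R u + b *\<^sub>R v)"
      by (metis add.assoc add_diff_cancel_left' dist_commute dist_norm)
    also have "\<dots> \<le> a * norm u + b * norm v"
      using norm_triangle_ineq[of "a *\<^sub>R u" "b *\<^sub>R v"] that by simp
    also have "\<dots> \<le> t * (norm u + norm v)"
      using that by (simp add: distrib_left add_mono mult_right_mono)
    finally show "dist x (x + a *\<^sub>R u + b *\<^sub>R v) \<le> t * (norm u + norm v)" .
    then show "x + a *\<^sub>R u + b *\<^sub>R v \<in> ball x r"
      using assms(2) by simp
  qed
  have ab: "x + a *\<^sub>R u \<in> ball x r" if "0 \<le> a" "a \<le> t" for a
    using in_ball[of a 0] that \<open>0 < t\<close> by simp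
  define F where "F a = f (x + a *\<^sub>R u + t *\<^sub>R v) - f (x + a *\<^sub>R u)" for a
  have "(F has_derivative
      (\<lambda>h. f' (x + a *\<^sub>R u + t *\<^sub>R v) (h *\<^sub>R u) - f' (x + a *\<^sub>R u) (h *\<^sub>R u))) (at a)"
    if "0 \<le> a" "a \<le> t" for a
    unfolding F_def using that \<open>0 < t\<close> in_ball ab
    by (auto intro!: derivative_eq_intros has_derivative_compose[OF _ f'] simp: has_derivative_const)
  then have "\<exists>a\<in>{0<..<t}. F t - F 0 =
      (\<lambda>a h. f' (x + a *\<^sub>R u + t *\<^sub>R v) (h *\<^sub>R u) - f' (x + a *\<^sub>R u) (h *\<^sub>R u)) a (t - 0)"
    by (intro mvt_simple[OF \<open>0 < t\<close>]) (auto intro: has_derivative_at_withinI)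
  then obtain a where a: "0 < a" "a < t"
    and Fa: "F t - F 0 = f' (x + a *\<^sub>R u + t *\<^sub>R v) (t *\<^sub>R u) - f' (x + a *\<^sub>R u) (t *\<^sub>R u)"
    by auto
  have lin: "f' y (t *\<^sub>R u) = t * f' y u" if "y \<in> ball x r" for y
    using linear_cmul[OF has_derivative_linear[OF f'[OF that]]] by simp
  have Fa': "F t - F 0 = t * (f' (x + a *\<^sub>R u + t *\<^sub>R v) u - f' (x + a *\<^sub>R u) u)"
    using a \<open>0 < t\<close> by (simp add: Fa lin in_ball ab right_diff_distrib del: mem_ball)
  define H where "H b = f' (x + a *\<^sub>R u + b *\<^sub>R v) u" for b
  have "(H has_derivative (\<lambda>h. P (x + a *\<^sub>R u + b *\<^sub>R v) (h *\<^sub>R v))) (at b)"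
    if "0 \<le> b" "b \<le> t" for b
    unfolding H_def using that a in_ball
    by (auto intro!: derivative_eq_intros has_derivative_compose[OF _ P] simp: has_derivative_const)
  then have "\<exists>b\<in>{0<..<t}. H t - H 0 =
      (\<lambda>b h. P (x + a *\<^sub>R u + b *\<^sub>R v) (h *\<^sub>R v)) b (t - 0)"
    by (intro mvt_simple[OF \<open>0 < t\<close>]) (auto intro: has_derivative_at_withinI)
  then obtain b where b: "0 < b" "b < t" and Hb: "H t - H 0 = P (x + a *\<^sub>R u + b *\<^sub>R v) (t *\<^sub>R v)"
    by auto
  have "P (x + a *\<^sub>R u + b *\<^sub>R v) (t *\<^sub>R v) = t * P (x + a *\<^sub>R u + b *\<^sub>R v) v"
    using linear_cmul[OF has_derivative_linear[OF P[OF in_ball]]] a b by simp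
  then have "F t - F 0 = t * t * P (x + a *\<^sub>R u + b *\<^sub>R v) v"
    using Fa' Hb by (simp add: H_def)
  then show thesis
    using that[of "x + a *\<^sub>R u + b *\<^sub>R v"] dist_le a b by (simp add: F_def algebra_simps)
qed

lemma second_derivative_symmetric_real:
  fixes f :: "'a::real_normed_vector \<Rightarrow> real"
  assumes "open U" "x \<in> U"
    and f': "\<And>y. y \<in> U \<Longrightarrow> (f has_derivative f' y) (at y)"
    and P: "\<And>y. y \<in> U \<Longrightarrow> ((\<lambda>z. f' z u) has_derivative P y) (at y)"
    and Q: "\<And>y. y \<in> U \<Longrightarrow> ((\<lambda>z. f' z v) has_derivative Q y) (at y)"
    and "isCont (\<lambda>y. P y v) x" "isCont (\<lambda>y. Q y u) x"
  shows "P x v = Q x u"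
proof (rule ccontr)
  assume "P x v \<noteq> Q x u"
  \<comment> \<open>Half the supposed gap: values within \<open>e\<close> of \<open>P x v\<close>
    and of \<open>Q x u\<close> cannot coincide.\<close>
  define e where "e = \<bar>P x v - Q x u\<bar> / 2"
  have "0 < e"
    using \<open>P x v \<noteq> Q x u\<close> by (simp add: e_def)
  obtain r where r: "0 < r" "ball x r \<subseteq> U"
    using assms(1,2) openE by blast
  obtain d1 where d1: "0 < d1" "\<And>y. dist y x < d1 \<Longrightarrow> dist (P y v) (P x v) < e"
    using \<open>isCont (\<lambda>y. P y v) x\<close> \<open>0 < e\<close> unfolding continuous_at_eps_delta by blast
  obtain d2 where d2: "0 < d2" "\<And>y. dist y x < d2 \<Longrightarrow> dist (Q y u) (Q x u) < e"
    using \<open>isCont (\<lambda>y. Q y u) x\<close> \<open>0 < e\<close> unfolding continuous_at_eps_delta by blast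
  define s where "s = Min {r, d1, d2}"
  have s: "0 < s" "s \<le> r" "s \<le> d1" "s \<le> d2"
    using r d1 d2 by (auto simp: s_def)
  \<comment> \<open>The summand 1 keeps the denominator positive when \<open>u = v = 0\<close> and
    makes the inequality \<open>ts\<close> strict.\<close>
  define t where "t = s / (norm u + norm v + 1)"
  have n: "0 < norm u + norm v + 1"
    by (simp add: add_nonneg_pos)
  have "0 < t"
    using s n by (simp add: t_def)
  have ts: "t * (norm u + norm v) < s"
    using s n by (simp add: t_def field_simps)
  then have ts': "t * (norm v + norm u) < s"
    by (simp add: add.commute)
  obtain y where y: "dist x y \<le> t * (norm u + norm v)"
    and Py: "f (x + t *\<^sub>R u + t *\<^sub>R v) - f (x + t *\<^sub>R u) - f (x + t *\<^sub>R v) + f x = t * t * P y v"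
    using second_difference_mvt[of t u v s x f f' P] \<open>0 < t\<close> ts f' P s r
    by (smt (verit, ccfv_threshold) mem_ball subset_iff)
  obtain z where z: "dist x z \<le> t * (norm v + norm u)"
    and Qz: "f (x + t *\<^sub>R v + t *\<^sub>R u) - f (x + t *\<^sub>R v) - f (x + t *\<^sub>R u) + f x = t * t * Q z u"
    using second_difference_mvt[of t v u s x f f' Q] \<open>0 < t\<close> ts' f' Q s r
    by (smt (verit, ccfv_threshold) mem_ball subset_iff)
  have swap: "x + t *\<^sub>R v + t *\<^sub>R u = x + t *\<^sub>R u + t *\<^sub>R v"
    by simp
  have "t * t * P y v = t * t * Q z u"
    using Py Qz[unfolded swap] by linarith
  then have "P y v = Q z u"
    using \<open>0 < t\<close> by simp
  moreover have "dist (P y v) (P x v) < e"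
    using y ts s d1(2)[of y] by (simp add: dist_commute)
  moreover have "dist (Q z u) (Q x u) < e"
    using z ts' s d2(2)[of z] by (simp add: dist_commute)
  ultimately show False
    unfolding e_def dist_real_def by (simp add: abs_if split: if_splits)
qed

text \<open>Pairing with an arbitrary vector \<open>w\<close> reduces the claim to real-valued
  functions.\<close>

lemma second_derivative_symmetric:
  fixes f :: "'a::real_normed_vector \<Rightarrow> 'b::real_inner"
  assumes "open U" "x \<in> U"
    and f': "\<And>y. y \<in> U \<Longrightarrow> (f has_derivative f' y) (at y)"
    and P: "\<And>y. y \<in> U \<Longrightarrow> ((\<lambda>z. f' z u) has_derivative P y) (at y)"
    and Q: "\<And>y. y \<in> U \<Longrightarrow> ((\<lambda>z. f' z v) has_derivative Q y) (at y)"
    and "isCont (\<lambda>y. P y v) x" "isCont (\<lambda>y. Q y u) x"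
  shows "P x v = Q x u"
proof (rule vector_eq_rdot[THEN iffD1], rule allI)
  fix w
  show "P x v \<bullet> w = Q x u \<bullet> w"
    by (rule second_derivative_symmetric_real[of U x "\<lambda>y. f y \<bullet> w" "\<lambda>y h. f' y h \<bullet> w" u
          "\<lambda>y h. P y h \<bullet> w" v "\<lambda>y h. Q y h \<bullet> w"])
      (use assms in \<open>auto intro!: has_derivative_inner_left continuous_intros\<close>)
qed

lemma Ck_on_second_derivative_symmetric:
  fixes F :: "'a::euclidean_space \<Rightarrow> 'b::real_inner"
  assumes "open U" "x \<in> U" "Ck_on (Suc (Suc 0)) U F"
  shows "frechet_derivative (\<lambda>z. frechet_derivative F (at z) u) (at x) v =
    frechet_derivative (\<lambda>z. frechet_derivative F (at z) v) (at x) u"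
proof (rule second_derivative_symmetric[OF assms(1,2)])
  show "(F has_derivative frechet_derivative F (at y)) (at y)" if "y \<in> U" for y
    using assms(3) that by (rule Ck_on_Suc_has_derivative)
  have 1: "Ck_on (Suc 0) U (\<lambda>z. frechet_derivative F (at z) w)" for w
    using assms(3) by (simp only: Ck_on.simps(2)[of "Suc 0"])
  then have 2: "((\<lambda>z. frechet_derivative F (at z) w) has_derivative
      frechet_derivative (\<lambda>z. frechet_derivative F (at z) w) (at y)) (at y)" if "y \<in> U" for y w
    using that by (rule Ck_on_Suc_has_derivative)
  have 3: "isCont (\<lambda>y. frechet_derivative (\<lambda>z. frechet_derivative F (at z) w) (at y) w') x" for w w'
    using 1 assms(1,2) by (auto simp: continuous_on_eq_continuous_at)
  show "((\<lambda>z. frechet_derivative F (at z) u) has_derivative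
      frechet_derivative (\<lambda>z. frechet_derivative F (at z) u) (at y)) (at y)"
    "((\<lambda>z. frechet_derivative F (at z) v) has_derivative
      frechet_derivative (\<lambda>z. frechet_derivative F (at z) v) (at y)) (at y)" if "y \<in> U" for y
    using that by (rule 2)+
  show "isCont (\<lambda>y. frechet_derivative (\<lambda>z. frechet_derivative F (at z) u) (at y) v) x"
    "isCont (\<lambda>y. frechet_derivative (\<lambda>z. frechet_derivative F (at z) v) (at y) u) x"
    by (rule 3)+
qed

text \<open>Product rule for a derivative taken along a moving direction. The second-order term
  appears with its two directions exchanged, which symmetry permits.\<close>

lemma has_derivative_directional_derivative:
  fixes F :: "'a::euclidean_space \<Rightarrow> 'b::real_inner" and G :: "'a \<Rightarrow> 'a"
  assumes "open U" "x \<in> U" "Ck_on (Suc (Suc 0)) U F" "Ck_on (Suc 0) U G"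
  shows "((\<lambda>z. frechet_derivative F (at z) (G z)) has_derivative
    (\<lambda>v. frechet_derivative F (at x) (frechet_derivative G (at x) v) +
      frechet_derivative (\<lambda>z. frechet_derivative F (at z) v) (at x) (G x))) (at x)"
proof -
  let ?F' = "\<lambda>z. frechet_derivative F (at z)"
  let ?F'' = "\<lambda>u. frechet_derivative (\<lambda>z. ?F' z u) (at x)"
  have 1: "Ck_on (Suc 0) U (\<lambda>z. ?F' z w)" for w
    using assms(3) by (simp only: Ck_on.simps(2)[of "Suc 0"])
  have linF: "linear (?F' z)" if "z \<in> U" for z
    using assms(3) that by (simp add: linear_frechet_derivative)
  have linF'': "linear (?F'' u)" for u
    using 1[of u] assms(2) by (simp add: linear_frechet_derivative)
  have expand: "T w = (\<Sum>b\<in>Basis. (w \<bullet> b) *\<^sub>R T b)" if "linear T"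
    for T :: "'a \<Rightarrow> 'b" and w
    using linear_sum[OF that, of "\<lambda>b. (w \<bullet> b) *\<^sub>R b" Basis]
    by (simp add: euclidean_representation linear_cmul[OF that])
  have G: "(G has_derivative frechet_derivative G (at x)) (at x)"
    using assms(4,2) by (rule Ck_on_Suc_has_derivative)
  have F': "((\<lambda>z. ?F' z b) has_derivative ?F'' b) (at x)" for b
    using 1 assms(2) by (rule Ck_on_Suc_has_derivative)
  have "((\<lambda>z. \<Sum>b\<in>Basis. (G z \<bullet> b) *\<^sub>R ?F' z b) has_derivative
      (\<lambda>v. \<Sum>b\<in>Basis. (G x \<bullet> b) *\<^sub>R ?F'' b v + (frechet_derivative G (at x) v \<bullet> b) *\<^sub>R ?F' x b)) (at x)"
    by (intro has_derivative_sum has_derivative_scaleR has_derivative_inner_left G F')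
  moreover have "(\<Sum>b\<in>Basis. (G x \<bullet> b) *\<^sub>R ?F'' b v + (frechet_derivative G (at x) v \<bullet> b) *\<^sub>R ?F' x b)
      = ?F' x (frechet_derivative G (at x) v) + ?F'' v (G x)" for v
  proof -
    \<comment> \<open>\<open>?F'' v\<close> is linear in its last argument; once \<open>b\<close>
      stands there, the sum over the basis collapses to \<open>?F'' v (G x)\<close>.\<close>
    have "(\<Sum>b\<in>Basis. (G x \<bullet> b) *\<^sub>R ?F'' b v) = (\<Sum>b\<in>Basis. (G x \<bullet> b) *\<^sub>R ?F'' v b)"
      using Ck_on_second_derivative_symmetric[OF assms(1-3)] by (intro sum.cong) auto
    then show ?thesis
      by (simp only: sum.distrib expand[OF linF'', symmetric] expand[OF linF[OF assms(2)], symmetric]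
          add.commute)
  qed
  ultimately have "((\<lambda>z. \<Sum>b\<in>Basis. (G z \<bullet> b) *\<^sub>R ?F' z b) has_derivative
      (\<lambda>v. ?F' x (frechet_derivative G (at x) v) + ?F'' v (G x))) (at x)"
    by simp
  then show ?thesis
    by (rule has_derivative_transform_within_open[OF _ assms(1,2)]) (metis expand linF)
qed


subsection \<open>Differential calculus on the sphere\<close>

lemma S3_iff: "p \<in> S3 \<longleftrightarrow> p \<bullet> p = 1"
  by (simp add: norm_eq_1 dist_norm)

text \<open>The great circle through \<open>p\<close> with velocity \<open>v\<close> turns a
  derivative relative to the sphere into an ordinary derivative in one real variable. It serves both
  the uniqueness of differentials and the first-order condition at a maximum.\<close>

lemma has_derivative_S3_curve:
  assumes p: "p \<in> S3" and v: "v \<in> tangent_space p"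
  obtains \<gamma> where "\<gamma> 0 = p" "range \<gamma> \<subseteq> S3"
    "\<And>(f :: cc \<Rightarrow> 'b::real_normed_vector) f'. (f has_derivative f') (at p within S3) \<Longrightarrow>
      ((\<lambda>t. f (\<gamma> t)) has_derivative (\<lambda>h. f' (h *\<^sub>R v))) (at (0::real))"
proof -
  \<comment> \<open>includes the constant curve for \<open>v = 0\<close>, as \<open>x / 0 = 0\<close>\<close>
  define \<gamma> where "\<gamma> t = cos (norm v * t) *\<^sub>R p + (sin (norm v * t) / norm v) *\<^sub>R v" for t
  have \<gamma>0: "\<gamma> 0 = p"
    by (simp add: \<gamma>_def)
  have "\<gamma> t \<bullet> \<gamma> t = 1" for t
  proof -
    have "\<gamma> t \<bullet> \<gamma> t = (cos (norm v * t))\<^sup>2 * (p \<bullet> p) + (sin (norm v * t) / norm v)\<^sup>2 * (v \<bullet> v)"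
      using v by (simp add: \<gamma>_def tangent_space_def inner_add_left inner_add_right inner_commute
          power2_eq_square)
    also have "\<dots> = (cos (norm v * t))\<^sup>2 + (sin (norm v * t))\<^sup>2"
      using p by (cases "v = 0") (auto simp: S3_iff power_divide simp flip: power2_norm_eq_inner)
    finally show ?thesis by simp
  qed
  then have range: "range \<gamma> \<subseteq> S3"
    by (auto simp only: S3_iff)
  have "((\<lambda>t. sin (norm v * t) / norm v) has_derivative (\<lambda>h. h * (if v = 0 then 0 else 1))) (at 0)"
    by (cases "v = 0") (auto intro!: derivative_eq_intros)
  then have "(\<gamma> has_derivative (\<lambda>h. h *\<^sub>R v)) (at 0)"
    unfolding \<gamma>_def by (cases "v = 0") (auto intro!: derivative_eq_intros)
  then have "((\<lambda>t. f (\<gamma> t)) has_derivative (\<lambda>h. f' (h *\<^sub>R v))) (at 0)"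
    if "(f has_derivative f') (at p within S3)" for f :: "cc \<Rightarrow> 'b" and f'
    using has_derivative_in_compose[of \<gamma> _ 0 UNIV f f'] has_derivative_subset[OF that range] \<gamma>0
    by simp
  with \<gamma>0 range show thesis
    using that by blast
qed

text \<open>Along the curve with velocity \<open>v\<close>, any two derivatives relative to the
  sphere become derivatives of the same function of one real variable, hence agree on
  \<open>v\<close>.\<close>

lemma d_S3_eqI:
  fixes f :: "cc \<Rightarrow> 'b::real_normed_vector"
  assumes "(f has_derivative f') (at p within S3)" "p \<in> S3" "v \<in> tangent_space p"
  shows "d_S3 f p v = f' v"
proof -
  obtain \<gamma> where "\<gamma> 0 = p" "range \<gamma> \<subseteq> S3" and \<gamma>: "\<And>(f :: cc \<Rightarrow> 'b) f'. (f has_derivative f') (at p within S3) \<Longrightarrow>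
      ((\<lambda>t. f (\<gamma> t)) has_derivative (\<lambda>h. f' (h *\<^sub>R v))) (at (0::real))"
    by (rule has_derivative_S3_curve[OF assms(2,3)]) (rule that)
  have "(f has_derivative frechet_derivative f (at p within S3)) (at p within S3)"
    using assms(1) frechet_derivative_works differentiable_def by blast
  from has_derivative_unique[OF \<gamma>[OF this] \<gamma>[OF assms(1)]] show ?thesis
    by (metis d_S3_def scaleR_one)
qed

text \<open>Both functions have the same set of derivatives at \<open>p\<close>, so the choice
  operator selects the same one; the equality therefore holds even off the tangent space.\<close>

lemma d_S3_cong:
  assumes "\<And>q. q \<in> S3 \<Longrightarrow> f q = g q" "p \<in> S3"
  shows "d_S3 f p = d_S3 g p"
proof -
  have "(f has_derivative D) (at p within S3) \<longleftrightarrow> (g has_derivative D) (at p within S3)" for D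
    using has_derivative_transform[of p S3 f g D] has_derivative_transform[of p S3 g f D] assms by metis
  then show ?thesis
    unfolding d_S3_def frechet_derivative_def by presburger
qed

text \<open>Main access to smoothness: one local extension computes \<open>d_S3\<close> at all
  nearby points of the sphere, so that differentials can themselves be differentiated.\<close>

lemma smooth_S3E:
  fixes f :: "cc \<Rightarrow> 'b::real_normed_vector"
  assumes "smooth_S3 f" "p \<in> S3"
  obtains U F where "open U" "p \<in> U" "\<And>k. Ck_on k U F" "\<And>q. q \<in> U \<Longrightarrow> q \<in> S3 \<Longrightarrow> F q = f q"
    "\<And>q. q \<in> U \<Longrightarrow> q \<in> S3 \<Longrightarrow> (f has_derivative frechet_derivative F (at q)) (at q within S3)"
    "\<And>q v. q \<in> U \<Longrightarrow> q \<in> S3 \<Longrightarrow> v \<in> tangent_space q \<Longrightarrow> d_S3 f q v = frechet_derivative F (at q) v"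
proof -
  obtain U F where U: "open U" "p \<in> U" and F': "\<forall>k. Ck_on k U F"
    and eq': "\<forall>q\<in>U \<inter> S3. F q = f q"
    using assms(1)[unfolded smooth_S3_def, rule_format, OF assms(2)] by metis
  have F: "Ck_on k U F" for k
    using F' by simp
  have eq: "F q = f q" if "q \<in> U" "q \<in> S3" for q
    using eq' that by simp
  have der: "(f has_derivative frechet_derivative F (at q)) (at q within S3)"
    if "q \<in> U" "q \<in> S3" for q
  proof (rule has_derivative_transform_eventually)
    show "(F has_derivative frechet_derivative F (at q)) (at q within S3)"
      using Ck_on_Suc_has_derivative[OF F that(1)] by (rule has_derivative_at_withinI)
    show "\<forall>\<^sub>F x in at q within S3. F x = f x"
      unfolding eventually_at_topological using U(1) that(1) eq by blast
  qed (use that eq in auto)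
  show thesis
    using that[OF U F eq der d_S3_eqI[OF der]] by simp
qed

lemma smooth_S3_has_derivative:
  assumes "smooth_S3 f" "p \<in> S3"
  shows "(f has_derivative d_S3 f p) (at p within S3)"
proof -
  obtain D where "(f has_derivative D) (at p within S3)"
    using assms by (metis smooth_S3E)
  then show ?thesis
    unfolding d_S3_def using frechet_derivative_works differentiable_def by blast
qed

section \<open>Closure properties of smooth functions on the sphere\<close>

lemma smooth_S3I:
  assumes "\<And>p. p \<in> S3 \<Longrightarrow> \<exists>U F. open U \<and> p \<in> U \<and> (\<forall>k. Ck_on k U F) \<and> (\<forall>q\<in>U \<inter> S3. F q = f q)"
  shows "smooth_S3 f"
  using assms unfolding smooth_S3_def by blast

lemma smooth_S3_const: "smooth_S3 (\<lambda>q. c)"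
  by (rule smooth_S3I) (use Ck_on_const in blast)

lemma smooth_S3_linear:
  assumes "bounded_linear T"
  shows "smooth_S3 T"
  by (rule smooth_S3I) (use Ck_on_bounded_linear[OF assms open_UNIV] in blast)

lemma smooth_S3_linear_compose:
  assumes "bounded_linear T" "smooth_S3 f"
  shows "smooth_S3 (\<lambda>q. T (f q))"
proof (rule smooth_S3I)
  fix p assume "p \<in> S3"
  then obtain U F where "open U" "p \<in> U" "\<And>k. Ck_on k U F" "\<And>q. q \<in> U \<Longrightarrow> q \<in> S3 \<Longrightarrow> F q = f q"
    using smooth_S3E[OF assms(2)] by metis
  then show "\<exists>U F. open U \<and> p \<in> U \<and> (\<forall>k. Ck_on k U F) \<and> (\<forall>q\<in>U \<inter> S3. F q = T (f q))"
    by (intro exI[of _ U] exI[of _ "\<lambda>x. T (F x)"]) (auto intro: Ck_on_bounded_linear_compose[OF _ assms(1)])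
qed

lemma smooth_S3_bilinear:
  assumes "bounded_bilinear h" "smooth_S3 f" "smooth_S3 g"
  shows "smooth_S3 (\<lambda>q. h (f q) (g q))"
proof (rule smooth_S3I)
  fix p assume p: "p \<in> S3"
  obtain U F where U: "open U" "p \<in> U" "\<And>k. Ck_on k U F" "\<And>q. q \<in> U \<Longrightarrow> q \<in> S3 \<Longrightarrow> F q = f q"
    using smooth_S3E[OF assms(2) p] by metis
  obtain V G where V: "open V" "p \<in> V" "\<And>k. Ck_on k V G" "\<And>q. q \<in> V \<Longrightarrow> q \<in> S3 \<Longrightarrow> G q = g q"
    using smooth_S3E[OF assms(3) p] by metis
  have FG: "Ck_on k (U \<inter> V) F" "Ck_on k (U \<inter> V) G" "open (U \<inter> V)" for k
    using U(1) V(1) by (auto intro: Ck_on_subset[OF U(3)] Ck_on_subset[OF V(3)])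
  have "Ck_on k (U \<inter> V) (\<lambda>x. h (F x) (G x))" for k
    by (rule Ck_on_bilinear[OF FG(3) assms(1) FG(1,2)])
  then show "\<exists>U F. open U \<and> p \<in> U \<and> (\<forall>k. Ck_on k U F) \<and> (\<forall>q\<in>U \<inter> S3. F q = h (f q) (g q))"
    using U V by (intro exI[of _ "U \<inter> V"] exI[of _ "\<lambda>x. h (F x) (G x)"]) auto
qed

lemma smooth_S3_add:
  assumes "smooth_S3 f" "smooth_S3 g"
  shows "smooth_S3 (\<lambda>q. f q + g q)"
proof (rule smooth_S3I)
  fix p assume p: "p \<in> S3"
  obtain U F where U: "open U" "p \<in> U" "\<And>k. Ck_on k U F" "\<And>q. q \<in> U \<Longrightarrow> q \<in> S3 \<Longrightarrow> F q = f q"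
    using smooth_S3E[OF assms(1) p] by metis
  obtain V G where V: "open V" "p \<in> V" "\<And>k. Ck_on k V G" "\<And>q. q \<in> V \<Longrightarrow> q \<in> S3 \<Longrightarrow> G q = g q"
    using smooth_S3E[OF assms(2) p] by metis
  have FG: "Ck_on k (U \<inter> V) F" "Ck_on k (U \<inter> V) G" "open (U \<inter> V)" for k
    using U(1) V(1) by (auto intro: Ck_on_subset[OF U(3)] Ck_on_subset[OF V(3)])
  have "Ck_on k (U \<inter> V) (\<lambda>x. F x + G x)" for k
    by (rule Ck_on_add[OF FG(3,1,2)])
  then show "\<exists>U F. open U \<and> p \<in> U \<and> (\<forall>k. Ck_on k U F) \<and> (\<forall>q\<in>U \<inter> S3. F q = f q + g q)"
    using U V by (intro exI[of _ "U \<inter> V"] exI[of _ "\<lambda>x. F x + G x"]) auto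
qed

lemma smooth_S3_diff:
  "smooth_S3 f \<Longrightarrow> smooth_S3 g \<Longrightarrow> smooth_S3 (\<lambda>q. f q - g q)"
  using smooth_S3_add[of f "\<lambda>q. - g q"]
    smooth_S3_linear_compose[OF bounded_linear_minus[OF bounded_linear_ident], of g] by simp

lemma smooth_S3_d_S3:
  fixes f :: "cc \<Rightarrow> 'b::real_normed_vector"
  assumes "smooth_S3 f" "smooth_vfield Y"
  shows "smooth_S3 (\<lambda>q. d_S3 f q (Y q))"
proof (rule smooth_S3I)
  fix p assume p: "p \<in> S3"
  obtain U F where U: "open U" "p \<in> U" "\<And>k. Ck_on k U F"
    "\<And>q v. q \<in> U \<Longrightarrow> q \<in> S3 \<Longrightarrow> v \<in> tangent_space q \<Longrightarrow> d_S3 f q v = frechet_derivative F (at q) v"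
    using smooth_S3E[OF assms(1) p] by metis
  have Y: "smooth_S3 Y" "\<And>q. q \<in> S3 \<Longrightarrow> Y q \<in> tangent_space q"
    using assms(2) by (auto simp: smooth_vfield_def)
  obtain V G where V: "open V" "p \<in> V" "\<And>k. Ck_on k V G" "\<And>q. q \<in> V \<Longrightarrow> q \<in> S3 \<Longrightarrow> G q = Y q"
    using smooth_S3E[OF Y(1) p] by metis
  have "Ck_on k (U \<inter> V) (\<lambda>x. frechet_derivative F (at x) (G x))" for k
    using U(1) V(1) Ck_on_subset[OF U(3)] Ck_on_subset[OF V(3)]
    by (intro Ck_on_directional_derivative) blast+
  then show "\<exists>U F. open U \<and> p \<in> U \<and> (\<forall>k. Ck_on k U F) \<and> (\<forall>q\<in>U \<inter> S3. F q = d_S3 f q (Y q))"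
    using U V Y(2)
    by (intro exI[of _ "U \<inter> V"] exI[of _ "\<lambda>x. frechet_derivative F (at x) (G x)"]) auto
qed

text \<open>Obtained by differentiating the identity \<open>Y q \<bullet> q = 0\<close>. It gives
  the normal component of the ambient derivative of a tangent field.\<close>

lemma d_S3_inner_position:
  assumes "smooth_vfield Y" "p \<in> S3" "v \<in> tangent_space p"
  shows "d_S3 Y p v \<bullet> p = - (Y p \<bullet> v)"
proof -
  have Y: "(Y has_derivative d_S3 Y p) (at p within S3)"
    using assms by (simp add: smooth_vfield_def smooth_S3_has_derivative)
  have "d_S3 (\<lambda>q. Y q \<bullet> q) p v = Y p \<bullet> v + d_S3 Y p v \<bullet> p"
    by (rule d_S3_eqI[OF has_derivative_inner[OF Y has_derivative_ident] assms(2,3)])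
  moreover have "d_S3 (\<lambda>q. Y q \<bullet> q) p v = d_S3 (\<lambda>q. 0) p v"
    using assms by (intro fun_cong[OF d_S3_cong]) (auto simp: smooth_vfield_def tangent_space_def)
  moreover have "d_S3 (\<lambda>q. 0::real) p v = 0"
    by (rule d_S3_eqI[OF has_derivative_const assms(2,3)])
  ultimately show ?thesis by simp
qed

section \<open>Lie brackets as commutators of derivations\<close>

lemma smooth_vfield_lie_bracket:
  assumes "smooth_vfield X" "smooth_vfield Y"
  shows "smooth_vfield (lie_bracket X Y)"
  unfolding smooth_vfield_def
proof (intro conjI ballI)
  show "smooth_S3 (lie_bracket X Y)"
    unfolding lie_bracket_def using assms
    by (intro smooth_S3_diff smooth_S3_d_S3) (auto simp: smooth_vfield_def)
  \<comment> \<open>The normal components of the two ambient derivatives are both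
    \<open>- (X p \<bullet> Y p)\<close> and cancel.\<close>
  show "lie_bracket X Y p \<in> tangent_space p" if "p \<in> S3" for p
    using assms that d_S3_inner_position[of X p "Y p"] d_S3_inner_position[of Y p "X p"]
    by (simp add: smooth_vfield_def tangent_space_def lie_bracket_def inner_diff_left inner_diff_right inner_commute)
qed

text \<open>For a local extension \<open>F\<close>, each iterated derivative is a first-order term
  plus a second derivative of \<open>F\<close> along \<open>X p\<close> and \<open>Y p\<close>. The
  second-order parts cancel by symmetry and the first-order parts combine to the bracket.\<close>

lemma lie_bracket_commutator:
  fixes f :: "cc \<Rightarrow> 'b::real_inner"
  assumes "smooth_S3 f" "smooth_vfield X" "smooth_vfield Y" and p: "p \<in> S3"
  shows "d_S3 (\<lambda>q. d_S3 f q (Y q)) p (X p) - d_S3 (\<lambda>q. d_S3 f q (X q)) p (Y p) =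
    d_S3 f p (lie_bracket X Y p)"
proof -
  obtain U F where U: "open U" "p \<in> U" "\<And>k. Ck_on k U F"
    and f: "\<And>q v. q \<in> U \<Longrightarrow> q \<in> S3 \<Longrightarrow> v \<in> tangent_space q \<Longrightarrow> d_S3 f q v = frechet_derivative F (at q) v"
    using smooth_S3E[OF assms(1) p] by metis
  let ?D2 = "\<lambda>v. frechet_derivative (\<lambda>z. frechet_derivative F (at z) v) (at p)"
  have *: "d_S3 (\<lambda>q. d_S3 f q (B q)) p (A p) =
      frechet_derivative F (at p) (d_S3 B p (A p)) + ?D2 (A p) (B p)"
    if "smooth_vfield A" "smooth_vfield B" for A B
  proof -
    have B: "smooth_S3 B" "\<And>q. q \<in> S3 \<Longrightarrow> B q \<in> tangent_space q" and Ap: "A p \<in> tangent_space p"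
      using that p by (auto simp: smooth_vfield_def)
    obtain V G where V: "open V" "p \<in> V" "\<And>k. Ck_on k V G" "\<And>q. q \<in> V \<Longrightarrow> q \<in> S3 \<Longrightarrow> G q = B q"
      and dB: "\<And>q v. q \<in> V \<Longrightarrow> q \<in> S3 \<Longrightarrow> v \<in> tangent_space q \<Longrightarrow> d_S3 B q v = frechet_derivative G (at q) v"
      using smooth_S3E[OF B(1) p] by metis
    have "((\<lambda>z. frechet_derivative F (at z) (G z)) has_derivative
        (\<lambda>v. frechet_derivative F (at p) (frechet_derivative G (at p) v) + ?D2 v (G p))) (at p within S3)"
    proof (rule has_derivative_at_withinI[OF has_derivative_directional_derivative[of "U \<inter> V" p F G]])
      show "open (U \<inter> V)" "p \<in> U \<inter> V"
        using U V by auto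
    qed (simp_all only: Ck_on_subset[OF U(3)] Ck_on_subset[OF V(3)] Int_lower1 Int_lower2)
    then have "((\<lambda>q. d_S3 f q (B q)) has_derivative
        (\<lambda>v. frechet_derivative F (at p) (frechet_derivative G (at p) v) + ?D2 v (G p))) (at p within S3)"
    proof (rule has_derivative_transform_eventually)
      show "\<forall>\<^sub>F x in at p within S3. frechet_derivative F (at x) (G x) = d_S3 f x (B x)"
        unfolding eventually_at_topological using U V B f by (intro exI[of _ "U \<inter> V"]) auto
    qed (use U V B f p in auto)
    from d_S3_eqI[OF this p Ap] show ?thesis
      using dB[OF V(2) p Ap] V(4)[OF V(2) p] by simp
  qed
  have "linear (frechet_derivative F (at p))"
    using U(2) U(3)[of "Suc 0"] by (simp add: linear_frechet_derivative)
  then have "frechet_derivative F (at p) (d_S3 Y p (X p)) - frechet_derivative F (at p) (d_S3 X p (Y p)) =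
      frechet_derivative F (at p) (lie_bracket X Y p)"
    by (simp add: lie_bracket_def linear_diff)
  moreover have "frechet_derivative F (at p) (lie_bracket X Y p) = d_S3 f p (lie_bracket X Y p)"
    using f[OF U(2) p] smooth_vfield_lie_bracket[OF assms(2,3)] p by (simp add: smooth_vfield_def)
  moreover have "?D2 (X p) (Y p) = ?D2 (Y p) (X p)"
    by (rule Ck_on_second_derivative_symmetric[OF U(1,2,3)])
  ultimately show ?thesis
    using *[OF assms(2,3)] *[OF assms(3,2)] by simp
qed

lemmas smooth_S3_scaleR = smooth_S3_bilinear[OF bounded_bilinear_scaleR]
  and smooth_S3_inner = smooth_S3_bilinear[OF bounded_bilinear_inner]
  and smooth_S3_mult = smooth_S3_bilinear[OF bounded_bilinear_mult]
  and smooth_S3_ident = smooth_S3_linear[OF bounded_linear_ident]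

section \<open>Extension of tangent vectors and uniqueness of the Levi-Civita connection\<close>

lemma smooth_vfield_extension:
  assumes "v \<in> tangent_space p" "p \<in> S3"
  obtains X where "smooth_vfield X" "X p = v"
proof
  \<comment> \<open>The constant vector \<open>v\<close> is projected orthogonally to each tangent
    space.\<close>
  show "smooth_vfield (\<lambda>q. v - (v \<bullet> q) *\<^sub>R q)"
    unfolding smooth_vfield_def
    by (intro conjI smooth_S3_diff smooth_S3_scaleR smooth_S3_inner smooth_S3_const smooth_S3_ident ballI)
      (simp add: tangent_space_def inner_diff_left S3_iff del: mem_sphere mem_sphere_0)
  show "v - (v \<bullet> p) *\<^sub>R p = v"
    using assms by (simp add: tangent_space_def)
qed

text \<open>The difference of two such connections, lowered with \<open>g\<close>, is symmetric in
  its first two arguments and skew in its last two; these symmetries force it to vanish.\<close>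

lemma is_levi_civita_unique:
  assumes g: "riemannian_metric g" and D: "is_levi_civita g D" and D': "is_levi_civita g D'"
    and X: "smooth_vfield X" and Y: "smooth_vfield Y" and p: "p \<in> S3"
  shows "D X Y p = D' X Y p"
proof -
  have tan: "X p \<in> tangent_space p" if "smooth_vfield X" for X
    using that p by (simp add: smooth_vfield_def)
  have smD: "smooth_vfield (D X Y)" "smooth_vfield (D' X Y)"
    if "smooth_vfield X" "smooth_vfield Y" for X Y
    using D D' that by (simp_all add: is_levi_civita_def affine_connection_def)
  have lin: "g p (a *\<^sub>R u + b *\<^sub>R v) w = a * g p u w + b * g p v w"
    if "u \<in> tangent_space p" "v \<in> tangent_space p" "w \<in> tangent_space p" for a b u v w
    using g p that unfolding riemannian_metric_def by blast
  have sym: "g p u v = g p v u" if "u \<in> tangent_space p" "v \<in> tangent_space p" for u v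
    using g p that unfolding riemannian_metric_def by blast
  define T where "T X Y Z = g p (D X Y p) (Z p) - g p (D' X Y p) (Z p)" for X Y Z
  have T: "T X Y Z = g p (D X Y p - D' X Y p) (Z p)"
    if "smooth_vfield X" "smooth_vfield Y" "smooth_vfield Z" for X Y Z
    using lin[of "D X Y p" "D' X Y p" "Z p" 1 "-1"] that by (simp add: T_def tan smD)
  have T_sym: "T X Y Z = T Y X Z"
    if "smooth_vfield X" "smooth_vfield Y" "smooth_vfield Z" for X Y Z
  proof -
    have "D X Y p - D Y X p = D' X Y p - D' Y X p"
      using D D' that p unfolding is_levi_civita_def by simp
    then have "D X Y p - D' X Y p = D Y X p - D' Y X p"
      by (simp add: algebra_simps)
    then show ?thesis using that by (simp add: T)
  qed
  have T_skew: "T X Y Z = - T X Z Y"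
    if "smooth_vfield X" "smooth_vfield Y" "smooth_vfield Z" for X Y Z
  proof -
    have "d_S3 (\<lambda>q. g q (Y q) (Z q)) p (X p) = g p (D X Y p) (Z p) + g p (Y p) (D X Z p)"
      using D that p unfolding is_levi_civita_def by blast
    moreover have "d_S3 (\<lambda>q. g q (Y q) (Z q)) p (X p) = g p (D' X Y p) (Z p) + g p (Y p) (D' X Z p)"
      using D' that p unfolding is_levi_civita_def by blast
    ultimately show ?thesis
      using that sym[of "Y p" "D X Z p"] sym[of "Y p" "D' X Z p"] by (simp add: T_def tan smD)
  qed
  let ?A = "D X Y p - D' X Y p"
  have "?A \<in> tangent_space p"
    using tan[OF smD(1)[OF X Y]] tan[OF smD(2)[OF X Y]] by (simp add: tangent_space_def inner_diff_left)
  \<comment> \<open>With this \<open>Z\<close>, the number \<open>T X Y Z\<close> is the squared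
    length of the difference \<open>?A\<close>.\<close>
  then obtain Z where Z: "smooth_vfield Z" "Z p = ?A"
    using smooth_vfield_extension p by blast
  \<comment> \<open>Alternate swaps: XYZ = YXZ = -YZX = -ZYX = ZXY = XZY = -XYZ.\<close>
  have "T X Y Z = - T X Y Z"
    using T_sym T_skew X Y Z by metis
  then have "g p ?A ?A = 0"
    using T[OF X Y Z(1)] Z(2) by simp
  then have "?A = 0"
    using g p \<open>?A \<in> tangent_space p\<close> unfolding riemannian_metric_def by (metis less_irrefl)
  then show ?thesis by simp
qed


subsection \<open>The Levi-Civita connection of the Berger metric\<close>

lemma vert_linear [simp]:
  "vert (x + y) = vert x + vert y" "vert (x - y) = vert x - vert y" "vert (- x) = - vert x"
  "vert (r *\<^sub>R x) = r *\<^sub>R vert x" "vert 0 = 0"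
  by (simp_all add: vert_def prod_eq_iff algebra_simps)

lemma bounded_linear_vert: "bounded_linear vert"
  by (rule linear_conv_bounded_linear[THEN iffD1]) (rule linearI; simp)

lemma inner_vert_left: "vert x \<bullet> y = - (x \<bullet> vert y)"
  by (simp add: vert_def inner_prod_def inner_complex_def)

lemma vert_vert [simp]: "vert (vert x) = - x"
  by (simp add: vert_def prod_eq_iff flip: mult.assoc)

lemma inner_vert_self [simp]: "x \<bullet> vert x = 0"
  using inner_vert_left[of x x] by (simp add: inner_commute)

lemmas smooth_S3_vert = smooth_S3_linear_compose[OF bounded_linear_vert]

lemmas smooth_S3_intros = smooth_S3_add smooth_S3_diff smooth_S3_scaleR smooth_S3_inner
  smooth_S3_mult smooth_S3_vert smooth_S3_const smooth_S3_ident

lemma smooth_vfield_smooth_S3: "smooth_vfield X \<Longrightarrow> smooth_S3 X"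
  and smooth_vfield_tangent: "smooth_vfield X \<Longrightarrow> p \<in> S3 \<Longrightarrow> X p \<in> tangent_space p"
  by (simp_all add: smooth_vfield_def)

lemma smooth_vfield_has_derivative:
  "smooth_vfield X \<Longrightarrow> p \<in> S3 \<Longrightarrow> (X has_derivative d_S3 X p) (at p within S3)"
  by (simp add: smooth_vfield_def smooth_S3_has_derivative)

lemma vert_has_derivative:
  assumes "(f has_derivative f') F"
  shows "((\<lambda>x. vert (f x)) has_derivative (\<lambda>h. vert (f' h))) F"
  by (rule bounded_linear.has_derivative[OF bounded_linear_vert assms])

lemma riemannian_metric_berger:
  assumes "\<kappa> > 0" "4 * \<tau>\<^sup>2 > \<kappa>"
  shows "riemannian_metric (berger_metric \<kappa> \<tau>)"
  unfolding riemannian_metric_def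
proof (intro conjI ballI allI impI)
  fix p u v w :: cc and a b :: real
  show "berger_metric \<kappa> \<tau> p (a *\<^sub>R u + b *\<^sub>R v) w =
      a * berger_metric \<kappa> \<tau> p u w + b * berger_metric \<kappa> \<tau> p v w"
    by (simp add: berger_metric_def inner_add_left algebra_simps)
  show "berger_metric \<kappa> \<tau> p u v = berger_metric \<kappa> \<tau> p v u"
    by (simp add: berger_metric_def inner_commute)
next
  fix p u :: cc assume "u \<noteq> 0"
  \<comment> \<open>Since \<open>4 * \<tau>\<^sup>2 > \<kappa>\<close>, the vertical term can only
    increase the Euclidean square norm.\<close>
  have "0 \<le> (4 * \<tau>\<^sup>2 / \<kappa> - 1) * (u \<bullet> vert p)\<^sup>2"
    using assms by (intro mult_nonneg_nonneg) (simp_all add: field_simps)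
  then have "0 < u \<bullet> u + (4 * \<tau>\<^sup>2 / \<kappa> - 1) * (u \<bullet> vert p)\<^sup>2"
    using \<open>u \<noteq> 0\<close> by (simp add: add_pos_nonneg)
  then show "berger_metric \<kappa> \<tau> p u u > 0"
    using assms(1) unfolding berger_metric_def by (simp add: power2_eq_square mult.assoc)
next
  fix Y Z assume "smooth_vfield Y" "smooth_vfield Z"
  then show "smooth_S3 (\<lambda>p. berger_metric \<kappa> \<tau> p (Y p) (Z p))"
    unfolding berger_metric_def by (intro smooth_S3_intros smooth_vfield_smooth_S3)
qed

text \<open>
  \<open>conn_form\<close> is the second fundamental form of the round sphere (the term \<open>(x \<bullet> y) *\<^sub>R p\<close>) plus the
  difference tensor of the Levi-Civita connections of the metrics
  \<open>\<langle>x, y\<rangle> + c \<langle>x, V\<rangle> \<langle>y, V\<rangle>\<close> and \<open>\<langle>x, y\<rangle>\<close>.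
\<close>

definition conn_form :: "real \<Rightarrow> cc \<Rightarrow> cc \<Rightarrow> cc \<Rightarrow> cc" where
  "conn_form c p x y = (x \<bullet> y) *\<^sub>R p + c *\<^sub>R ((x \<bullet> vert p) *\<^sub>R vert y + (y \<bullet> vert p) *\<^sub>R vert x +
     (2 * (x \<bullet> vert p) * (y \<bullet> vert p)) *\<^sub>R p)"

definition berger_connection :: "real \<Rightarrow> vfield \<Rightarrow> vfield \<Rightarrow> vfield" where
  "berger_connection c X Y = (\<lambda>p. d_S3 Y p (X p) + conn_form c p (X p) (Y p))"

lemma conn_form_commute: "conn_form c p x y = conn_form c p y x"
  by (simp add: conn_form_def inner_commute algebra_simps)

lemma conn_form_add_left: "conn_form c p (x + x') y = conn_form c p x y + conn_form c p x' y"
  by (simp add: conn_form_def inner_add_left algebra_simps)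

lemma conn_form_diff_left: "conn_form c p (x - x') y = conn_form c p x y - conn_form c p x' y"
  by (simp add: conn_form_def inner_diff_left algebra_simps)

lemma conn_form_scaleR_left: "conn_form c p (r *\<^sub>R x) y = r *\<^sub>R conn_form c p x y"
  by (simp add: conn_form_def algebra_simps)

lemma conn_form_add_right: "conn_form c p y (x + x') = conn_form c p y x + conn_form c p y x'"
  by (simp add: conn_form_commute[of c p y] conn_form_add_left)

lemma conn_form_scaleR_right: "conn_form c p y (r *\<^sub>R x) = r *\<^sub>R conn_form c p y x"
  by (simp add: conn_form_commute[of c p y] conn_form_scaleR_left)

text \<open>Because \<open>vert y \<bullet> p = - (y \<bullet> vert p)\<close>, the two
  \<open>vert\<close> terms contribute minus twice the product of vertical components, which the
  factor 2 in \<open>conn_form\<close> compensates. What remains cancels the normal part in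
  \<open>d_S3_inner_position\<close>, so the connection is tangent.\<close>

lemma inner_conn_form_position:
  assumes "p \<in> S3"
  shows "conn_form c p x y \<bullet> p = x \<bullet> y"
proof -
  have "p \<bullet> p = 1"
    using assms by (simp only: S3_iff)
  then show ?thesis
    by (simp add: conn_form_def inner_add_left inner_vert_left algebra_simps)
qed

lemma smooth_vfield_berger_connection:
  assumes "smooth_vfield X" "smooth_vfield Y"
  shows "smooth_vfield (berger_connection c X Y)"
  unfolding smooth_vfield_def
proof (intro conjI ballI)
  show "smooth_S3 (berger_connection c X Y)"
    unfolding berger_connection_def conn_form_def
    using assms by (intro smooth_S3_intros smooth_S3_d_S3 smooth_vfield_smooth_S3)
  show "berger_connection c X Y p \<in> tangent_space p" if "p \<in> S3" for p
    using d_S3_inner_position[OF assms(2) that smooth_vfield_tangent[OF assms(1) that]]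
      inner_conn_form_position[OF that]
    by (simp add: tangent_space_def berger_connection_def inner_add_left inner_commute[of "X p"])
qed

lemma affine_connection_berger: "affine_connection (berger_connection c)"
  unfolding affine_connection_def
proof (intro conjI allI impI ballI)
  fix X Y :: vfield
  assume "smooth_vfield X" "smooth_vfield Y"
  then show "smooth_vfield (berger_connection c X Y)"
    by (rule smooth_vfield_berger_connection)
next
  fix X X' Y :: vfield and p :: cc
  assume "smooth_vfield X" "smooth_vfield X'" "smooth_vfield Y" and p: "p \<in> S3"
  have "linear (d_S3 Y p)"
    using smooth_vfield_has_derivative[OF \<open>smooth_vfield Y\<close> p] by (rule has_derivative_linear)
  then show "berger_connection c (\<lambda>q. X q + X' q) Y p =
      berger_connection c X Y p + berger_connection c X' Y p"
    by (simp add: berger_connection_def linear_add conn_form_add_left)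
next
  fix f :: "cc \<Rightarrow> real" and X Y :: vfield and p :: cc
  assume "smooth_S3 f" "smooth_vfield X" "smooth_vfield Y" and p: "p \<in> S3"
  have "linear (d_S3 Y p)"
    using smooth_vfield_has_derivative[OF \<open>smooth_vfield Y\<close> p] by (rule has_derivative_linear)
  then show "berger_connection c (\<lambda>q. f q *\<^sub>R X q) Y p = f p *\<^sub>R berger_connection c X Y p"
    by (simp add: berger_connection_def linear_cmul conn_form_scaleR_left scaleR_add_right)
next
  fix X Y Y' :: vfield and p :: cc
  assume X: "smooth_vfield X" and Y: "smooth_vfield Y" "smooth_vfield Y'" and p: "p \<in> S3"
  have "d_S3 (\<lambda>q. Y q + Y' q) p (X p) = d_S3 Y p (X p) + d_S3 Y' p (X p)"
    by (rule d_S3_eqI[OF has_derivative_add[OF Y[THEN smooth_vfield_has_derivative, OF p]]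
          p smooth_vfield_tangent[OF X p]])
  then show "berger_connection c X (\<lambda>q. Y q + Y' q) p =
      berger_connection c X Y p + berger_connection c X Y' p"
    by (simp add: berger_connection_def conn_form_add_right)
next
  fix f :: "cc \<Rightarrow> real" and X Y :: vfield and p :: cc
  assume f: "smooth_S3 f" and X: "smooth_vfield X" and Y: "smooth_vfield Y" and p: "p \<in> S3"
  have "d_S3 (\<lambda>q. f q *\<^sub>R Y q) p (X p) = f p *\<^sub>R d_S3 Y p (X p) + d_S3 f p (X p) *\<^sub>R Y p"
    by (rule d_S3_eqI[OF has_derivative_scaleR[OF smooth_S3_has_derivative[OF f p]
            smooth_vfield_has_derivative[OF Y p]] p smooth_vfield_tangent[OF X p]])
  then show "berger_connection c X (\<lambda>q. f q *\<^sub>R Y q) p =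
      d_S3 f p (X p) *\<^sub>R Y p + f p *\<^sub>R berger_connection c X Y p"
    by (simp add: berger_connection_def conn_form_scaleR_right scaleR_add_right)
qed

text \<open>Product rule; the last summand comes from differentiating the vertical field, whose
  derivative along \<open>x\<close> is \<open>vert x\<close> by linearity.\<close>

lemma d_S3_berger_metric:
  assumes "smooth_vfield Y" "smooth_vfield Z" "p \<in> S3" "x \<in> tangent_space p"
  shows "d_S3 (\<lambda>q. berger_metric \<kappa> \<tau> q (Y q) (Z q)) p x =
    berger_metric \<kappa> \<tau> p (d_S3 Y p x) (Z p) + berger_metric \<kappa> \<tau> p (Y p) (d_S3 Z p x) +
    4 / \<kappa> * (4 * \<tau>\<^sup>2 / \<kappa> - 1) * ((Y p \<bullet> vert x) * (Z p \<bullet> vert p) + (Y p \<bullet> vert p) * (Z p \<bullet> vert x))"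
proof -
  note Y = smooth_vfield_has_derivative[OF assms(1,3)]
  note Z = smooth_vfield_has_derivative[OF assms(2,3)]
  note V = vert_has_derivative[OF has_derivative_ident, of "at p within S3"]
  show ?thesis
    unfolding berger_metric_def
    by (rule d_S3_eqI[OF has_derivative_mult_right[OF has_derivative_add[OF
              has_derivative_inner[OF Y Z] has_derivative_mult[OF has_derivative_mult_right[OF
                has_derivative_inner[OF Y V]] has_derivative_inner[OF Z V]]]] assms(3,4), THEN trans])
      (simp add: algebra_simps add_divide_distrib)
qed

lemma is_levi_civita_berger:
  assumes "c = 4 * \<tau>\<^sup>2 / \<kappa> - 1"
  shows "is_levi_civita (berger_metric \<kappa> \<tau>) (berger_connection c)"
  unfolding is_levi_civita_def
proof (intro conjI allI impI ballI)
  show "affine_connection (berger_connection c)"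
    by (rule affine_connection_berger)
next
  fix X Y :: vfield and p :: cc
  show "berger_connection c X Y p - berger_connection c Y X p = lie_bracket X Y p"
    using conn_form_commute[of c p "X p" "Y p"] by (simp add: berger_connection_def lie_bracket_def)
next
  fix X Y Z :: vfield and p :: cc
  assume X: "smooth_vfield X" and Y: "smooth_vfield Y" and Z: "smooth_vfield Z" and p: "p \<in> S3"
  have vert_skew: "x \<bullet> vert y = - (y \<bullet> vert x)" for x y
    using inner_vert_left[of y x] by (simp add: inner_commute)
  \<comment> \<open>Added to its copy with \<open>y\<close> and \<open>z\<close> exchanged, this
    loses its \<open>x \<bullet> vert p\<close> terms because \<open>vert\<close> is skew. The rest
    is exactly the metric-coefficient term of \<open>d_S3_berger_metric\<close>.\<close>
  have skew: "berger_metric \<kappa> \<tau> p (conn_form c p x y) z =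
      4 / \<kappa> * c * (- (x \<bullet> vert p) * (y \<bullet> vert z) - (y \<bullet> vert p) * (x \<bullet> vert z))"
    if "x \<in> tangent_space p" "y \<in> tangent_space p" "z \<in> tangent_space p" for x y z
    using that unfolding berger_metric_def assms[symmetric]
    by (simp add: conn_form_def tangent_space_def inner_add_left inner_vert_left inner_commute
        vert_skew[of z x] vert_skew[of z y] algebra_simps)
  note tangent = X[THEN smooth_vfield_tangent, OF p] Y[THEN smooth_vfield_tangent, OF p]
    Z[THEN smooth_vfield_tangent, OF p]
  have add_left: "berger_metric \<kappa> \<tau> p (u + v) w = berger_metric \<kappa> \<tau> p u w + berger_metric \<kappa> \<tau> p v w"
    and sym: "berger_metric \<kappa> \<tau> p u v = berger_metric \<kappa> \<tau> p v u" for u v w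
    by (simp_all add: berger_metric_def inner_add_left inner_commute algebra_simps add_divide_distrib)
  have add_right: "berger_metric \<kappa> \<tau> p w (u + v) = berger_metric \<kappa> \<tau> p w u + berger_metric \<kappa> \<tau> p w v"
    for u v w
    using add_left sym by metis
  show "d_S3 (\<lambda>q. berger_metric \<kappa> \<tau> q (Y q) (Z q)) p (X p) =
      berger_metric \<kappa> \<tau> p (berger_connection c X Y p) (Z p) +
      berger_metric \<kappa> \<tau> p (Y p) (berger_connection c X Z p)"
    unfolding berger_connection_def add_left add_right sym[of "Y p" "conn_form c p (X p) (Z p)"]
      skew[OF tangent(1,2,3)] skew[OF tangent(1,3,2)] d_S3_berger_metric[OF Y Z p tangent(1)]
      assms[symmetric] vert_skew[of "Z p" "Y p"] vert_skew[of "X p"]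
    by (simp add: algebra_simps)
qed

text \<open>The explicit connection shows that the choice in \<open>levi_civita\<close> has a
  witness; uniqueness then identifies the chosen connection with it on the sphere.\<close>

lemma
  assumes "\<kappa> > 0" "4 * \<tau>\<^sup>2 > \<kappa>" "smooth_vfield X" "smooth_vfield Y"
  shows levi_civita_berger:
      "p \<in> S3 \<Longrightarrow> levi_civita (berger_metric \<kappa> \<tau>) X Y p =
        berger_connection (4 * \<tau>\<^sup>2 / \<kappa> - 1) X Y p"
    and smooth_vfield_levi_civita_berger: "smooth_vfield (levi_civita (berger_metric \<kappa> \<tau>) X Y)"
proof -
  have LC: "is_levi_civita (berger_metric \<kappa> \<tau>) (levi_civita (berger_metric \<kappa> \<tau>))"
    unfolding levi_civita_def by (rule someI[of "is_levi_civita _", OF is_levi_civita_berger[OF refl]])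
  then show "smooth_vfield (levi_civita (berger_metric \<kappa> \<tau>) X Y)"
    using assms(3,4) by (simp add: is_levi_civita_def affine_connection_def)
  show "levi_civita (berger_metric \<kappa> \<tau>) X Y p = berger_connection (4 * \<tau>\<^sup>2 / \<kappa> - 1) X Y p"
    if "p \<in> S3"
    by (rule is_levi_civita_unique[OF riemannian_metric_berger[OF assms(1,2)] LC
          is_levi_civita_berger[OF refl] assms(3,4) that])
qed

subsection \<open>Curvature of the Berger metric\<close>

text \<open>The derivative of \<open>conn_form c p x y\<close> in the base point \<open>p\<close>
  along \<open>v\<close>, with \<open>x\<close> and \<open>y\<close> held fixed.\<close>

definition conn_form_deriv :: "real \<Rightarrow> cc \<Rightarrow> cc \<Rightarrow> cc \<Rightarrow> cc \<Rightarrow> cc" where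
  "conn_form_deriv c p v x y = (x \<bullet> y) *\<^sub>R v + c *\<^sub>R ((x \<bullet> vert v) *\<^sub>R vert y + (y \<bullet> vert v) *\<^sub>R vert x +
     (2 * ((x \<bullet> vert v) * (y \<bullet> vert p) + (x \<bullet> vert p) * (y \<bullet> vert v))) *\<^sub>R p +
     (2 * (x \<bullet> vert p) * (y \<bullet> vert p)) *\<^sub>R v)"

text \<open>The standard curvature expression dB + [B, B] of a connection d + B, with B given by
  \<open>conn_form\<close>.\<close>

definition curv_form :: "real \<Rightarrow> cc \<Rightarrow> cc \<Rightarrow> cc \<Rightarrow> cc \<Rightarrow> cc" where
  "curv_form c p x y z = conn_form_deriv c p x y z - conn_form_deriv c p y x z +
     conn_form c p x (conn_form c p y z) - conn_form c p y (conn_form c p x z)"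

lemma conn_form_has_derivative:
  assumes "smooth_vfield Y" "smooth_vfield Z" "p \<in> S3"
  shows "((\<lambda>q. conn_form c q (Y q) (Z q)) has_derivative
    (\<lambda>v. conn_form_deriv c p v (Y p) (Z p) + conn_form c p (d_S3 Y p v) (Z p) +
       conn_form c p (Y p) (d_S3 Z p v))) (at p within S3)"
proof -
  note Y = smooth_vfield_has_derivative[OF assms(1,3)]
  note Z = smooth_vfield_has_derivative[OF assms(2,3)]
  note I = has_derivative_ident[of "at p within S3"]
  note V = vert_has_derivative[OF I]
  note YZ = has_derivative_scaleR[OF has_derivative_inner[OF Y Z] I]
  note YV = has_derivative_scaleR[OF has_derivative_inner[OF Y V] vert_has_derivative[OF Z]]
  note ZV = has_derivative_scaleR[OF has_derivative_inner[OF Z V] vert_has_derivative[OF Y]]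
  note VV = has_derivative_scaleR[OF has_derivative_mult[OF
        has_derivative_mult_right[OF has_derivative_inner[OF Y V]] has_derivative_inner[OF Z V]] I]
  show ?thesis
    unfolding conn_form_def conn_form_deriv_def
    by (rule has_derivative_eq_rhs[OF has_derivative_add[OF YZ has_derivative_scaleR_right[OF
              has_derivative_add[OF has_derivative_add[OF YV ZV] VV]]]])
      (simp add: fun_eq_iff algebra_simps)
qed

text \<open>In the commutator of covariant derivatives, the mixed terms pairing a field with a
  derivative of \<open>Z\<close> are symmetric in \<open>X\<close> and \<open>Y\<close> and drop
  out. The second derivatives of \<open>Z\<close> and the derivatives of \<open>X\<close> and
  \<open>Y\<close> are absorbed by the bracket term, leaving an expression in values at
  \<open>p\<close>.\<close>

lemma
  assumes "\<kappa> > 0" "4 * \<tau>\<^sup>2 > \<kappa>" and c: "c = 4 * \<tau>\<^sup>2 / \<kappa> - 1"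
    and X: "smooth_vfield X" and Y: "smooth_vfield Y" and Z: "smooth_vfield Z" and p: "p \<in> S3"
  shows curvature_berger:
      "curvature (berger_metric \<kappa> \<tau>) X Y Z p = curv_form c p (X p) (Y p) (Z p)"
    and curvature_berger_tangent: "curvature (berger_metric \<kappa> \<tau>) X Y Z p \<in> tangent_space p"
proof -
  let ?L = "levi_civita (berger_metric \<kappa> \<tau>)"
  note L = levi_civita_berger[OF assms(1,2), folded c]
  note smL = smooth_vfield_levi_civita_berger[OF assms(1,2)]
  have LL: "?L A (?L B Z) p = d_S3 (\<lambda>q. d_S3 Z q (B q)) p (A p) +
      conn_form_deriv c p (A p) (B p) (Z p) + conn_form c p (d_S3 B p (A p)) (Z p) +
      conn_form c p (B p) (d_S3 Z p (A p)) + conn_form c p (A p) (d_S3 Z p (B p)) +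
      conn_form c p (A p) (conn_form c p (B p) (Z p))"
    if A: "smooth_vfield A" and B: "smooth_vfield B" for A B
  proof -
    have "d_S3 (?L B Z) p (A p) = d_S3 (\<lambda>q. d_S3 Z q (B q) + conn_form c q (B q) (Z q)) p (A p)"
      using L[OF B Z] p by (intro fun_cong[OF d_S3_cong]) (simp_all add: berger_connection_def)
    also have "\<dots> = d_S3 (\<lambda>q. d_S3 Z q (B q)) p (A p) +
        (conn_form_deriv c p (A p) (B p) (Z p) + conn_form c p (d_S3 B p (A p)) (Z p) +
         conn_form c p (B p) (d_S3 Z p (A p)))"
      by (rule d_S3_eqI[OF has_derivative_add[OF
              smooth_S3_has_derivative[OF smooth_S3_d_S3[OF smooth_vfield_smooth_S3[OF Z] B] p]
              conn_form_has_derivative[OF B Z p]] p smooth_vfield_tangent[OF A p]])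
    finally show ?thesis
      using L[OF A smL[OF B Z] p] L[OF B Z p] by (simp add: berger_connection_def conn_form_add_right)
  qed
  have "?L (lie_bracket X Y) Z p =
      d_S3 (\<lambda>q. d_S3 Z q (Y q)) p (X p) - d_S3 (\<lambda>q. d_S3 Z q (X q)) p (Y p) +
      conn_form c p (d_S3 Y p (X p)) (Z p) - conn_form c p (d_S3 X p (Y p)) (Z p)"
    using L[OF smooth_vfield_lie_bracket[OF X Y] Z p]
      lie_bracket_commutator[OF smooth_vfield_smooth_S3[OF Z] X Y p]
    by (simp add: berger_connection_def lie_bracket_def conn_form_diff_left)
  then show "curvature (berger_metric \<kappa> \<tau>) X Y Z p = curv_form c p (X p) (Y p) (Z p)"
    using LL[OF X Y] LL[OF Y X] by (simp add: curvature_def curv_form_def)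
  \<comment> \<open>Tangency is read off from the covariant derivatives rather than from the
    algebraic formula.\<close>
  show "curvature (berger_metric \<kappa> \<tau>) X Y Z p \<in> tangent_space p"
    using smooth_vfield_tangent[OF smL[OF X smL[OF Y Z]] p]
      smooth_vfield_tangent[OF smL[OF Y smL[OF X Z]] p]
      smooth_vfield_tangent[OF smL[OF smooth_vfield_lie_bracket[OF X Y] Z] p]
    by (simp add: tangent_space_def curvature_def inner_diff_left)
qed


subsection \<open>Ricci curvature of the Berger metric\<close>

text \<open>Basis independence of the trace: expand \<open>T b\<close> in \<open>E\<close> and
  \<open>e\<close> in the chosen basis, then exchange the sums. The map \<open>L\<close> need only
  agree with a linear map on \<open>W\<close>, as fits one built from
  \<open>extension_field\<close>, whose values off the tangent space are arbitrary.\<close>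

lemma trace_on_orthonormal:
  fixes E :: "'a::euclidean_space set"
  assumes E: "finite E" "pairwise orthogonal E" "\<And>e. e \<in> E \<Longrightarrow> norm e = 1" "span E = W"
    and T: "linear T" "\<And>x. x \<in> W \<Longrightarrow> T x \<in> W" "\<And>x. x \<in> W \<Longrightarrow> L x = T x"
  shows "trace_on W L = (\<Sum>e\<in>E. T e \<bullet> e)"
proof -
  define B where "B = (SOME B. independent B \<and> span B = W)"
  have "subspace W"
    using E(4) subspace_span by metis
  then have "\<exists>B. independent B \<and> span B = W"
    by (metis basis_exists span_subspace)
  then have B: "independent B" "span B = W"
    unfolding B_def by (metis (mono_tags, lifting) someI_ex)+
  have "finite B"
    using B(1) independent_imp_finite by blast
  have EW: "e \<in> W" if "e \<in> E" for e
    using that E(4) span_base by blast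
  have rep: "representation B (L b) b = (\<Sum>e\<in>E. (e \<bullet> T b) * representation B e b)" if "b \<in> B" for b
  proof -
    have "b \<in> W"
      using that B(2) span_base by blast
    then have "L b = (\<Sum>e\<in>E. (e \<bullet> T b) *\<^sub>R e)"
      using orthonormal_basis_expand[OF E(2,3) _ E(1), of "T b"] T(2,3) E(4)
      by (simp add: inner_commute[of _ "T b"])
    then show ?thesis
      using EW[folded B(2)] by (simp add: representation_sum representation_scale B(1) span_scale)
  qed
  have "trace_on W L = (\<Sum>b\<in>B. representation B (L b) b)"
    by (simp add: trace_on_def B_def[symmetric])
  also have "\<dots> = (\<Sum>e\<in>E. \<Sum>b\<in>B. (e \<bullet> T b) * representation B e b)"
    by (simp add: rep sum.swap[of _ E])
  also have "\<dots> = (\<Sum>e\<in>E. T e \<bullet> e)"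
  proof (rule sum.cong[OF refl])
    fix e assume "e \<in> E"
    then have "e = (\<Sum>b\<in>B. representation B e b *\<^sub>R b)"
      using sum_representation_eq[OF B(1) _ \<open>finite B\<close> order_refl] EW B(2) by simp
    then have "T e = (\<Sum>b\<in>B. representation B e b *\<^sub>R T b)"
      by (metis (no_types, lifting) T(1) linear_scale linear_sum sum.cong)
    then show "(\<Sum>b\<in>B. (e \<bullet> T b) * representation B e b) = T e \<bullet> e"
      by (simp add: inner_sum_left inner_commute[of e] mult.commute)
  qed
  finally show ?thesis .
qed

lemma linear_curv_form: "linear (\<lambda>x. curv_form c p x y z)"
  by (rule linearI)
    (simp_all add: curv_form_def conn_form_deriv_def conn_form_add_left conn_form_add_right
      conn_form_scaleR_left conn_form_scaleR_right inner_add_left inner_add_right algebra_simps)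

text \<open>Arranged so that \<open>e\<close> enters only through products
  \<open>(e \<bullet> a) * (e \<bullet> b)\<close>, ready for summation over an orthonormal basis by
  Parseval.\<close>

lemma inner_curv_form:
  assumes "e \<bullet> p = 0" "y \<bullet> p = 0" "z \<bullet> p = 0" "e \<bullet> e = 1"
  shows "curv_form c p e y z \<bullet> e = y \<bullet> z - (e \<bullet> y) * (e \<bullet> z) - 3 * c * ((e \<bullet> vert y) * (e \<bullet> vert z)) +
    (2 * c + c\<^sup>2) * (y \<bullet> vert p) * (z \<bullet> vert p) - (2 * c + c\<^sup>2) * (z \<bullet> vert p) * ((e \<bullet> y) * (e \<bullet> vert p))
    - c * (y \<bullet> vert p) * ((e \<bullet> z) * (e \<bullet> vert p)) + c * (y \<bullet> z) * ((e \<bullet> vert p) * (e \<bullet> vert p))"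
proof -
  have skew: "y \<bullet> vert e = - (e \<bullet> vert y)" "z \<bullet> vert e = - (e \<bullet> vert z)" "p \<bullet> vert e = - (e \<bullet> vert p)"
    using inner_vert_left[of e] by (simp_all add: inner_commute)
  have comm: "y \<bullet> e = e \<bullet> y" "z \<bullet> e = e \<bullet> z" "p \<bullet> e = 0" "p \<bullet> y = 0" "p \<bullet> z = 0" "z \<bullet> y = y \<bullet> z"
    using assms by (simp_all add: inner_commute)
  show ?thesis
    using assms
    by (simp add: curv_form_def conn_form_deriv_def conn_form_def inner_add_left inner_add_right
        inner_diff_left inner_vert_left skew comm algebra_simps power2_eq_square)
qed

lemma ricci_berger:
  assumes "\<kappa> > 0" "4 * \<tau>\<^sup>2 > \<kappa>" and c: "c = 4 * \<tau>\<^sup>2 / \<kappa> - 1"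
    and Y: "smooth_vfield Y" and Z: "smooth_vfield Z" and p: "p \<in> S3"
  shows "ricci (berger_metric \<kappa> \<tau>) Y Z p =
    (2 - 2 * c) * (Y p \<bullet> Z p) + (6 * c + 2 * c\<^sup>2) * (Y p \<bullet> vert p) * (Z p \<bullet> vert p)"
proof -
  let ?W = "tangent_space p"
  have pp: "p \<bullet> p = 1"
    using p by (simp only: S3_iff)
  have W: "?W = {x. p \<bullet> x = 0}"
    by (simp add: tangent_space_def inner_commute)
  \<comment> \<open>Orthonormality refers to the Euclidean product, not to the Berger metric; the
    trace is the same in any basis.\<close>
  obtain E where E: "pairwise orthogonal E" "\<And>e. e \<in> E \<Longrightarrow> norm e = 1" "independent E"
    "card E = dim ?W" "span E = ?W"
    using orthonormal_basis_subspace[of ?W] by (metis W subspace_hyperplane)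
  have "p \<noteq> 0"
    using pp by auto
  then have card: "card E = 3"
    using E(4) by (simp add: W dim_hyperplane)
  have "finite E"
    using E(3) independent_imp_finite by blast
  have EW: "e \<bullet> p = 0" "e \<bullet> e = 1" if "e \<in> E" for e
    using that E(2,5) span_base[of e E] by (auto simp: tangent_space_def norm_eq_1)
  \<comment> \<open>\<open>E\<close> spans only the complement of \<open>p\<close>, so the product
    of the normal components is subtracted.\<close>
  have parseval: "(\<Sum>e\<in>E. (e \<bullet> a) * (e \<bullet> b)) = a \<bullet> b - (a \<bullet> p) * (b \<bullet> p)" for a b
  proof -
    let ?a = "a - (a \<bullet> p) *\<^sub>R p"
    have "?a \<in> span E"
      by (simp add: E(5) tangent_space_def inner_diff_left pp)
    then have "?a \<bullet> b = (\<Sum>e\<in>E. (e \<bullet> ?a) *\<^sub>R e) \<bullet> b"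
      using orthonormal_basis_expand[OF E(1,2) _ \<open>finite E\<close>, of ?a] by (simp add: inner_commute[of _ ?a])
    also have "\<dots> = (\<Sum>e\<in>E. (e \<bullet> a) * (e \<bullet> b))"
      using EW by (simp add: inner_sum_left inner_diff_right)
    finally show ?thesis
      by (simp add: inner_diff_left inner_commute[of p])
  qed
  have tangent: "Y p \<bullet> p = 0" "Z p \<bullet> p = 0"
    using Y Z p by (auto simp: smooth_vfield_def tangent_space_def)
  have curv: "curvature (berger_metric \<kappa> \<tau>) (extension_field p x) Y Z p = curv_form c p x (Y p) (Z p)"
    and curv_tangent: "curv_form c p x (Y p) (Z p) \<in> ?W" if "x \<in> ?W" for x
  proof -
    have "\<exists>X. smooth_vfield X \<and> X p = x"
      using smooth_vfield_extension[OF that p] by metis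
    then have ext: "smooth_vfield (extension_field p x)" "extension_field p x p = x"
      unfolding extension_field_def by (metis (mono_tags, lifting) someI_ex)+
    show "curvature (berger_metric \<kappa> \<tau>) (extension_field p x) Y Z p = curv_form c p x (Y p) (Z p)"
      using curvature_berger[OF assms(1-3) ext(1) Y Z p] ext(2) by simp
    then show "curv_form c p x (Y p) (Z p) \<in> ?W"
      using curvature_berger_tangent[OF assms(1-3) ext(1) Y Z p] by simp
  qed
  have "ricci (berger_metric \<kappa> \<tau>) Y Z p = (\<Sum>e\<in>E. curv_form c p e (Y p) (Z p) \<bullet> e)"
    unfolding ricci_def
    by (rule trace_on_orthonormal[OF \<open>finite E\<close> E(1,2,5) linear_curv_form curv_tangent curv])
  also have "\<dots> = (\<Sum>e\<in>E. Y p \<bullet> Z p - (e \<bullet> Y p) * (e \<bullet> Z p) - 3 * c * ((e \<bullet> vert (Y p)) * (e \<bullet> vert (Z p))) +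
    (2 * c + c\<^sup>2) * (Y p \<bullet> vert p) * (Z p \<bullet> vert p)
    - (2 * c + c\<^sup>2) * (Z p \<bullet> vert p) * ((e \<bullet> Y p) * (e \<bullet> vert p))
    - c * (Y p \<bullet> vert p) * ((e \<bullet> Z p) * (e \<bullet> vert p)) + c * (Y p \<bullet> Z p) * ((e \<bullet> vert p) * (e \<bullet> vert p)))"
    by (intro sum.cong refl inner_curv_form EW tangent)
  also have "\<dots> = (2 - 2 * c) * (Y p \<bullet> Z p) + (6 * c + 2 * c\<^sup>2) * (Y p \<bullet> vert p) * (Z p \<bullet> vert p)"
    \<comment> \<open>The vectors \<open>vert (Y p)\<close> and \<open>vert (Z p)\<close> have
      normal components \<open>- (Y p \<bullet> vert p)\<close> and
      \<open>- (Z p \<bullet> vert p)\<close>, which Parseval turns into an extra multiple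
      \<open>3 * c\<close> of the vertical product.\<close>
    unfolding sum.distrib sum_subtractf sum_distrib_left[symmetric] parseval sum_constant card
    by (simp add: tangent tangent[unfolded inner_commute[of _ p]] pp inner_vert_left inner_commute
        algebra_simps power2_eq_square)
  finally show ?thesis .
qed


subsection \<open>Vertical fields and gradients\<close>

lemma inner_vert_vert: "vert x \<bullet> vert y = x \<bullet> y"
  by (simp add: inner_vert_left)

lemma smooth_vfield_scaled_vert: "smooth_vfield (\<lambda>p. r *\<^sub>R vert p)"
  unfolding smooth_vfield_def
  by (intro conjI ballI smooth_S3_intros) (simp add: tangent_space_def inner_vert_left)

text \<open>The vertical field generates the isometries \<open>p \<mapsto> exp (\<i> t) p\<close>.\<close>

lemma lie_derivative_scaled_vert:
  assumes Y: "smooth_vfield Y" and Z: "smooth_vfield Z" and p: "p \<in> S3"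
  shows "lie_derivative (\<lambda>p. r *\<^sub>R vert p) (berger_metric \<kappa> \<tau>) Y Z p = 0"
proof -
  note X = smooth_vfield_tangent[OF smooth_vfield_scaled_vert p]
  have dX: "d_S3 (\<lambda>q. r *\<^sub>R vert q) p v = r *\<^sub>R vert v" if "v \<in> tangent_space p" for v
    by (rule d_S3_eqI[OF has_derivative_scaleR_right[OF vert_has_derivative[OF has_derivative_ident]] p that])
  have tangent: "Y p \<bullet> p = 0" "Z p \<bullet> p = 0"
    using Y Z p by (auto simp: smooth_vfield_def tangent_space_def)
  show ?thesis
    unfolding lie_derivative_def lie_bracket_def dX[OF smooth_vfield_tangent[OF Y p]]
      dX[OF smooth_vfield_tangent[OF Z p]] d_S3_berger_metric[OF Y Z p X]
    by (simp add: berger_metric_def inner_diff_left inner_diff_right inner_vert_left inner_vert_vert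
        tangent inner_commute[of p] algebra_simps add_divide_distrib diff_divide_distrib)
qed

text \<open>By compactness \<open>f\<close> attains a maximum on the sphere. Along the great circle
  in any tangent direction, the restriction of \<open>f\<close> then has a local maximum at 0, so
  every directional derivative vanishes there.\<close>

lemma is_gradient_vanishes_somewhere:
  assumes f: "smooth_S3 f" and grad: "is_gradient g X f"
  obtains p where "p \<in> S3" "\<And>v. v \<in> tangent_space p \<Longrightarrow> g p (X p) v = 0"
proof -
  have "continuous_on S3 f"
    using has_derivative_continuous[OF smooth_S3_has_derivative[OF f]]
    by (simp add: continuous_on_eq_continuous_within)
  moreover have "S3 \<noteq> {}"
    using vector_choose_dist[of 1 "0 :: cc"] by auto
  ultimately obtain p where p: "p \<in> S3" and max: "\<And>q. q \<in> S3 \<Longrightarrow> f q \<le> f p"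
    using continuous_attains_sup[OF compact_sphere, of "0 :: cc" 1 f] by metis
  have "g p (X p) v = 0" if v: "v \<in> tangent_space p" for v
  proof -
    obtain \<gamma> where \<gamma>: "\<gamma> 0 = p" "range \<gamma> \<subseteq> S3"
      and chain: "\<And>(f :: cc \<Rightarrow> real) f'. (f has_derivative f') (at p within S3) \<Longrightarrow>
        ((\<lambda>t. f (\<gamma> t)) has_derivative (\<lambda>h. f' (h *\<^sub>R v))) (at (0::real))"
      by (rule has_derivative_S3_curve[OF p v]) (rule that)
    note der = smooth_S3_has_derivative[OF f p]
    have "((\<lambda>t. f (\<gamma> t)) has_derivative (\<lambda>h. d_S3 f p v * h)) (at 0)"
      using chain[OF der] by (simp add: linear_cmul[OF has_derivative_linear[OF der]] mult.commute)
    then have "((\<lambda>t. f (\<gamma> t)) has_real_derivative d_S3 f p v) (at 0)"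
      by (simp add: has_field_derivative_def)
    moreover have "f (\<gamma> t) \<le> f (\<gamma> 0)" for t
      using max[of "\<gamma> t"] \<gamma> by blast
    ultimately have "d_S3 f p v = 0"
      using DERIV_local_max[OF _ zero_less_one] by blast
    then show ?thesis
      using grad p v by (simp add: is_gradient_def)
  qed
  with p show thesis
    using that by blast
qed

section \<open>The quasi-Einstein equation on the Berger sphere and the absence of a
  potential\<close>

theorem mainTheorem4:
  fixes \<kappa> \<tau> m l :: real and g :: metric and X :: vfield
  assumes "\<kappa> > 0" and "\<tau> \<noteq> 0" and "4 * \<tau>\<^sup>2 > \<kappa>" and "0 < m"
    and "g = berger_metric \<kappa> \<tau>"
    and "X = (\<lambda>p. sqrt (m * (4 * \<tau>\<^sup>2 - \<kappa>)) *\<^sub>R berger_E3 \<kappa> \<tau> p)"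
    and "l = \<kappa> - 2 * \<tau>\<^sup>2"
  shows "(\<forall>Y Z. smooth_vfield Y \<longrightarrow> smooth_vfield Z \<longrightarrow>
           (\<forall>p\<in>S3. ricci g Y Z p + 1 / 2 * lie_derivative X g Y Z p
              - 1 / m * (flat g X Y p * flat g X Z p) = l * g p (Y p) (Z p))) \<and>
         quasi_einstein_structure m g X l \<and>
         (\<exists>p\<in>S3. X p \<noteq> 0) \<and>
         \<not> (\<exists>f. smooth_S3 f \<and> is_gradient g X f)"
proof -
  define s where "s = sqrt (m * (4 * \<tau>\<^sup>2 - \<kappa>))"
  define r where "r = s * (\<kappa> / (4 * \<tau>))"
  define c where "c = 4 * \<tau>\<^sup>2 / \<kappa> - 1"
  have s2: "s * s = m * (4 * \<tau>\<^sup>2 - \<kappa>)"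
    using assms(3,4) by (simp add: s_def)
  have "s \<noteq> 0" "r \<noteq> 0"
    using assms(1-4) by (simp_all add: s_def r_def)
  have X: "X = (\<lambda>p. r *\<^sub>R vert p)"
    by (simp add: assms(6) berger_E3_def r_def s_def)
  have smX: "smooth_vfield X"
    unfolding X by (rule smooth_vfield_scaled_vert)
  have X_nonzero: "X p \<noteq> 0" if "p \<in> S3" for p
  proof -
    have "vert p \<bullet> vert p = 1"
      using that by (simp only: inner_vert_vert S3_iff)
    then show ?thesis
      using \<open>r \<noteq> 0\<close> by (auto simp: X)
  qed
  have gm: "riemannian_metric g"
    unfolding assms(5) by (rule riemannian_metric_berger[OF assms(1,3)])
  have eq: "ricci g Y Z p + 1 / 2 * lie_derivative X g Y Z p
      - 1 / m * (flat g X Y p * flat g X Z p) = l * g p (Y p) (Z p)"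
    if Y: "smooth_vfield Y" and Z: "smooth_vfield Z" and p: "p \<in> S3" for Y Z p
  proof -
    have pp: "p \<bullet> p = 1"
      using p by (simp only: S3_iff)
    have flat: "flat g X W p = 4 * \<tau> * s / \<kappa> * (W p \<bullet> vert p)" for W
    proof -
      have "flat g X W p = 4 / \<kappa> * (r + c * r) * (W p \<bullet> vert p)"
        by (simp add: flat_def assms(5) berger_metric_def X c_def[symmetric] inner_vert_vert pp
            inner_commute algebra_simps add_divide_distrib)
      \<comment> \<open>Uses \<open>1 + c = 4 * \<tau>\<^sup>2 / \<kappa>\<close>, the squared
        length of the vertical field up to the factor \<open>4 / \<kappa>\<close>.\<close>
      also have "4 / \<kappa> * (r + c * r) = 4 * \<tau> * s / \<kappa>"
        using assms(1,2) by (simp add: r_def c_def field_simps power2_eq_square)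
      finally show ?thesis .
    qed
    have "1 / m * (flat g X Y p * flat g X Z p) =
        (16 * \<tau>\<^sup>2 * (s * s) / (m * \<kappa>\<^sup>2)) * (Y p \<bullet> vert p) * (Z p \<bullet> vert p)"
      using assms(1,4) by (simp add: flat field_simps power2_eq_square)
    \<comment> \<open>The square root in \<open>X\<close> is chosen so that \<open>s * s\<close>
      carries a factor \<open>m\<close> cancelling the \<open>1 / m\<close>.\<close>
    also have "16 * \<tau>\<^sup>2 * (s * s) / (m * \<kappa>\<^sup>2) = 4 * c * (1 + c)"
      using assms(1,4) by (simp add: s2 c_def field_simps power2_eq_square)
    finally have flat2: "1 / m * (flat g X Y p * flat g X Z p) =
        4 * c * (1 + c) * (Y p \<bullet> vert p) * (Z p \<bullet> vert p)" .
    have lie: "lie_derivative X g Y Z p = 0"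
      unfolding X assms(5) by (rule lie_derivative_scaled_vert[OF Y Z p])
    have "l * (4 / \<kappa>) = 2 - 2 * c"
      using assms(1) by (simp add: assms(7) c_def field_simps)
    then have "l * g p (Y p) (Z p) =
        (2 - 2 * c) * (Y p \<bullet> Z p + c * (Y p \<bullet> vert p) * (Z p \<bullet> vert p))"
      by (simp only: assms(5) berger_metric_def c_def[symmetric] mult.assoc[symmetric])
    \<comment> \<open>The remaining vertical coefficient is 6c + 2c^2 - 4c(1 + c) = c(2 - 2c), the
      same multiple \<open>2 - 2 * c\<close> of the metric as in the Euclidean part.\<close>
    then show ?thesis
      unfolding flat2 lie ricci_berger[OF assms(1,3) c_def Y Z p, folded assms(5)]
      by (simp add: algebra_simps power2_eq_square)
  qed
  have "\<not> is_gradient g X f" if f: "smooth_S3 f" for f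
  proof
    assume "is_gradient g X f"
    then obtain p where p: "p \<in> S3" and zero: "\<And>v. v \<in> tangent_space p \<Longrightarrow> g p (X p) v = 0"
      using is_gradient_vanishes_somewhere[OF f] by metis
    have Xp: "X p \<in> tangent_space p"
      by (rule smooth_vfield_tangent[OF smX p])
    \<comment> \<open>Testing the vanishing covector on \<open>X p\<close> itself contradicts
      positivity, since \<open>X\<close> has no zeros on the sphere.\<close>
    have "g p (X p) (X p) > 0"
      using gm p Xp X_nonzero[OF p] unfolding riemannian_metric_def by blast
    then show False
      using zero[OF Xp] by simp
  qed
  moreover have "\<exists>p\<in>S3. X p \<noteq> 0"
    using vector_choose_dist[of 1 "0 :: cc"] X_nonzero by (metis mem_sphere zero_le_one)
  ultimately show ?thesis
    using eq smX gm assms(4) unfolding quasi_einstein_structure_def by blast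
qed

end
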